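(* Let $k$ be an algebraically closed field of characteristic zero, and let $C_0$ be the rational curve of arithmetic genus two with two ordinary cusps, embedded tri-canonically in $\mathbb{P}^4$; explicitly, $C_0$ is the image of $$\nu:\mathbb{P}^1\to\mathbb{P}^4,\qquad [s,t]\mapsto [s^6,\ s^4t^2,\ s^3t^3,\ s^2t^4,\ t^6],$$ with homogeneous ideal $\langle x_3^2-x_1x_4,\ x_1x_3-x_0x_4,\ x_2^2-x_0x_4,\ x_1^2-x_0x_3\rangle\subset k[x_0,\dots,x_4]$. Then $C_0$ is $2$-Hilbert semistable.
   Context: The tri-canonical embedding is the embedding given by the complete linear system $|\omega_{C_0}^{\otimes 3}|$. Let $S_2$ be the $15$-dimensional space of quadratic forms in $x_0,\dots,x_4$. The restriction map $S_2\to H^0(C_0,\mathcal{O}_{C_0}(2))$ is surjective onto an $11$-dimensional space. The second Hilbert point $[C_0]_2$ is the point of $\mathbb{P}(\bigwedge^{11}S_2)$ determined by the one-dimensional quotient $$\textstyle\bigwedge^{11}S_2\to\bigwedge^{11}H^0(C_0,\mathcal{O}_{C_0}(2)).$$ The curve $C_0$ is called $2$-Hilbert semistable if $[C_0]_2$ is GIT semistable for the natural action of $SL_5(k)$ (acting by linear changes of the coordinates $x_0,\dots,x_4$) linearized by $\mathcal{O}(1)$ on this projective space. *)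

theory Defs
  imports
    "HOL-Analysis.Analysis"
    "HOL-Library.Poly_Mapping"
    "HOL-Library.Function_Algebras"
    "HOL-Computational_Algebra.Polynomial"
begin

section \<open>Polynomials in finitely many variables\<close>

text \<open>
  A polynomial with variables indexed by the finite type \<open>'n\<close> is a finitely supported function
  from exponent vectors to coefficients; its ring structure is the convolution product of
  \<^theory>\<open>HOL-Library.Poly_Mapping\<close>. For \<open>'n = 5\<close> the indices are the five residues
  \<open>0, 1, 2, 3, 4\<close>, matching the coordinates $x_0, \dots, x_4$.
\<close>

type_synonym ('k, 'n) mpoly = "('n \<Rightarrow>\<^sub>0 nat) \<Rightarrow>\<^sub>0 'k"

definition mvar :: "'n \<Rightarrow> ('k::comm_ring_1, 'n) mpoly"
  where "mvar i = Poly_Mapping.single (Poly_Mapping.single i 1) 1"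

definition mconst :: "'k::comm_ring_1 \<Rightarrow> ('k, 'n) mpoly"
  where "mconst c = Poly_Mapping.single 0 c"

definition mscale :: "'k::comm_ring_1 \<Rightarrow> ('k, 'n) mpoly \<Rightarrow> ('k, 'n) mpoly"
  where "mscale c p = mconst c * p"

definition meval :: "('k::comm_ring_1, 'n::finite) mpoly \<Rightarrow> 'k ^ 'n \<Rightarrow> 'k"
  where "meval p v =
    (\<Sum>m\<in>Poly_Mapping.keys p. Poly_Mapping.lookup p m *
       (\<Prod>i\<in>UNIV. (v $ i) ^ Poly_Mapping.lookup m i))"

definition forms :: "nat \<Rightarrow> ('k::comm_ring_1, 'n::finite) mpoly set"
  where "forms d = {p. \<forall>m\<in>Poly_Mapping.keys p. (\<Sum>i\<in>UNIV. Poly_Mapping.lookup m i) = d}"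

text \<open>
  The linear change of coordinates $x_i \mapsto \sum_j g_{ji} x_j$. With this placement of the
  indices it is a left action of matrices, extending the standard representation on the span of
  the variables.
\<close>

definition lin_change :: "'k ^ 'n ^ 'n \<Rightarrow> ('k::comm_ring_1, 'n::finite) mpoly \<Rightarrow> ('k, 'n) mpoly"
  where "lin_change g p =
    (\<Sum>m\<in>Poly_Mapping.keys p. mconst (Poly_Mapping.lookup p m) *
       (\<Prod>i\<in>UNIV. (\<Sum>j\<in>UNIV. mscale (g $ j $ i) (mvar j)) ^ Poly_Mapping.lookup m i))"

definition ideal_generated :: "('k::comm_ring_1, 'n) mpoly set \<Rightarrow> ('k, 'n) mpoly set"
  where "ideal_generated B = module.span (*) B"


section \<open>Projective varieties over an algebraically closed field\<close>

text \<open>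
  A subset of projective space is represented by the set \<open>C\<close> of all its (nonzero) homogeneous
  coordinate vectors.
\<close>

definition homogeneous_ideal :: "('k::field ^ 'n::finite) set \<Rightarrow> ('k, 'n) mpoly set"
  where "homogeneous_ideal C =
    ideal_generated {p. (\<exists>d. p \<in> forms d) \<and> (\<forall>v\<in>C. meval p v = 0)}"

text \<open>
  The global sections $H^0(C, \mathcal{O}_C(d))$ of a reduced closed subvariety, as functions on
  the punctured cone over it that are locally, in the Zariski topology, quotients of forms whose
  degrees differ by \<open>d\<close>. The open neighbourhoods can be taken to be the loci where the
  denominator does not vanish, since principal open sets form a basis. Functions are extended by
  zero outside the punctured cone so that equality of sections is equality of functions.
\<close>

definition twisted_sections :: "('k::field ^ 'n::finite) set \<Rightarrow> nat \<Rightarrow> ('k ^ 'n \<Rightarrow> 'k) set"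
  where "twisted_sections C d =
    {f. (\<forall>v. v \<notin> C \<longrightarrow> f v = 0) \<and>
        (\<forall>v\<in>C. \<exists>e. \<exists>P\<in>forms (e + d). \<exists>Q\<in>forms e. meval Q v \<noteq> 0 \<and>
           (\<forall>u\<in>C. meval Q u \<noteq> 0 \<longrightarrow> f u = meval P u / meval Q u))}"

definition restrict_form :: "('k::field ^ 'n::finite) set \<Rightarrow> ('k, 'n) mpoly \<Rightarrow> 'k ^ 'n \<Rightarrow> 'k"
  where "restrict_form C p = (\<lambda>v. if v \<in> C then meval p v else 0)"

definition fun_scale :: "'k::field \<Rightarrow> ('x \<Rightarrow> 'k) \<Rightarrow> 'x \<Rightarrow> 'k"
  where "fun_scale c f = (\<lambda>x. c * f x)"


section \<open>Exterior powers, via alternating forms\<close>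

text \<open>
  \<open>alternating_form sc V \<omega>\<close>: on the subspace \<open>V\<close>, \<open>\<omega>\<close> is an alternating multilinear form in
  \<open>CARD('i)\<close> arguments, i.e. a linear functional on $\bigwedge^{r} V$ for \<open>r = CARD('i)\<close>. Values of
  \<open>\<omega>\<close> on tuples that are not in \<open>V\<close> are irrelevant.
\<close>

definition alternating_form ::
  "('k::field \<Rightarrow> 'v::ab_group_add \<Rightarrow> 'v) \<Rightarrow> 'v set \<Rightarrow> (('i::finite \<Rightarrow> 'v) \<Rightarrow> 'k) \<Rightarrow> bool"
  where "alternating_form sc V \<omega> \<longleftrightarrow>
    (\<forall>w i a b x y. range w \<subseteq> V \<longrightarrow> x \<in> V \<longrightarrow> y \<in> V \<longrightarrow>
       \<omega> (w(i := sc a x + sc b y)) = a * \<omega> (w(i := x)) + b * \<omega> (w(i := y))) \<and>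
    (\<forall>w i j. range w \<subseteq> V \<longrightarrow> i \<noteq> j \<longrightarrow> w i = w j \<longrightarrow> \<omega> w = 0)"

text \<open>
  A point of $\mathbb{P}(\bigwedge^r S_2)$ is a one-dimensional quotient of $\bigwedge^r S_2$, so it
  is represented by a nonzero alternating \<open>r\<close>-form on $S_2$, up to scalars. Accordingly
  $H^0(\mathcal{O}(n)) = \mathrm{Sym}^n(\bigwedge^r S_2)$. Its elements are the polynomial functions
  of an alternating form \<open>\<eta>\<close> spanned by the \<open>n\<close>-fold products of the linear functions
  $\eta \mapsto \eta(f_1, \dots, f_r)$, which correspond to the elements
  $f_1 \wedge \dots \wedge f_r$ spanning $\bigwedge^r S_2$.
\<close>

definition O_sections ::
  "nat \<Rightarrow> ((('i::finite \<Rightarrow> ('k::field, 'n::finite) mpoly) \<Rightarrow> 'k) \<Rightarrow> 'k) set"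
  where "O_sections n = module.span fun_scale
    {F. \<exists>w. (\<forall>l<n. range (w l) \<subseteq> forms 2) \<and> F = (\<lambda>\<eta>. \<Prod>l<n. \<eta> (w l))}"

text \<open>
  Invariance is required for all of $SL$, so it does not matter that \<open>\<eta>\<close> is transformed by \<open>g\<close>
  rather than by its inverse.
\<close>

definition SL_invariant ::
  "((('i::finite \<Rightarrow> ('k::field, 'n::finite) mpoly) \<Rightarrow> 'k) \<Rightarrow> 'k) \<Rightarrow> bool"
  where "SL_invariant F \<longleftrightarrow>
    (\<forall>g :: 'k ^ 'n ^ 'n. det g = 1 \<longrightarrow>
      (\<forall>\<eta>. alternating_form mscale (forms 2) \<eta> \<longrightarrow> F (\<lambda>w. \<eta> (\<lambda>i. lin_change g (w i))) = F \<eta>))"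

text \<open>
  Semistability with respect to the linearization by $\mathcal{O}(1)$. The locus where a section
  of $\mathcal{O}(n)$, \<open>n > 0\<close>, does not vanish is automatically affine.
\<close>

definition GIT_semistable ::
  "(('i::finite \<Rightarrow> ('k::field, 'n::finite) mpoly) \<Rightarrow> 'k) \<Rightarrow> bool"
  where "GIT_semistable \<omega> \<longleftrightarrow> (\<exists>n>0. \<exists>F\<in>O_sections n. SL_invariant F \<and> F \<omega> \<noteq> 0)"


section \<open>Second Hilbert points\<close>

text \<open>
  \<open>\<omega>\<close> represents the second Hilbert point of \<open>C\<close>: the restriction map
  $S_2 \to H^0(C, \mathcal{O}_C(2))$ is surjective onto a space of dimension \<open>CARD('i)\<close>, and
  \<open>\<omega>\<close> is the induced map $\bigwedge^r S_2 \to \bigwedge^r H^0(C, \mathcal{O}_C(2))$ for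
  \<open>r = CARD('i)\<close>, followed by an isomorphism \<open>\<delta>\<close> of the one-dimensional target with the ground
  field. Thus \<open>\<omega>\<close> is unique up to a nonzero scalar.
\<close>

definition second_Hilbert_point ::
  "('k::field ^ 'n::finite) set \<Rightarrow> (('i::finite \<Rightarrow> ('k, 'n) mpoly) \<Rightarrow> 'k) \<Rightarrow> bool"
  where "second_Hilbert_point C \<omega> \<longleftrightarrow>
    restrict_form C ` forms 2 = twisted_sections C 2 \<and>
    vector_space.dim fun_scale (twisted_sections C 2) = CARD('i) \<and>
    (\<exists>\<delta>. alternating_form fun_scale (twisted_sections C 2) \<delta> \<and>
         (\<exists>u. range u \<subseteq> twisted_sections C 2 \<and> \<delta> u \<noteq> 0) \<and>
         \<omega> = (\<lambda>w :: 'i \<Rightarrow> ('k, 'n) mpoly. \<delta> (\<lambda>i. restrict_form C (w i))))"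

definition two_Hilbert_semistable :: "('k::field ^ 5) set \<Rightarrow> bool"
  where "two_Hilbert_semistable C \<longleftrightarrow>
    (\<exists>\<omega> :: (11 \<Rightarrow> ('k, 5) mpoly) \<Rightarrow> 'k. second_Hilbert_point C \<omega> \<and> GIT_semistable \<omega>)"


section \<open>The tri-canonical rational curve with two cusps\<close>

definition nu :: "'k::field \<Rightarrow> 'k \<Rightarrow> 'k ^ 5"
  where "nu s t = (\<chi> i. if i = 0 then s ^ 6 else if i = 1 then s ^ 4 * t ^ 2
    else if i = 2 then s ^ 3 * t ^ 3 else if i = 3 then s ^ 2 * t ^ 4 else t ^ 6)"

definition C0 :: "('k::field ^ 5) set"
  where "C0 = {c *s nu s t | c s t. c \<noteq> 0 \<and> (s, t) \<noteq> (0, 0)}"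

end

theory Submission
  imports Defs "HOL-Computational_Algebra.Polynomial_Factorial"
begin

text \<open>
  Let $K$ be the function field of the generic $5 \times 5$ matrix $g$. If $1$ is a polynomial without
  constant term in the degree-zero quotients $(g\omega)(w_1) \cdots (g\omega)(w_5) / \det(g)^{22}$,
  Cayley's Omega process turns this identity into an invariant that is nonzero at $\omega$. Otherwise
  there is a valuation on $K$ at which all these quotients are small. By the Iwasawa decomposition
  over the valuation ring, $g$ may be replaced by an upper triangular matrix. As the torus fixing
  $\omega$ acts on the coordinates with distinct weights, an upper triangular matrix multiplies a
  coordinate of $\omega$ by a torus character only, and five suitable coordinates of $\omega$ have
  characters with product $\det^{22}$: this is a contradiction.
\<close>

subsection \<open>Valuation rings\<close>

text \<open>Semistability asks for an actual invariant, so a check on one-parameter subgroups is not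
  enough: the hard direction of the Hilbert-Mumford criterion is needed. It is obtained here from a
  valuation of arbitrary value group, handled through divisibility in its ring alone. The numbers 5
  and 22: a coordinate of the translate of \<omega> has degree 2 * 11 = 22 in the entries of g, and
  det g has degree 5, so a product of r coordinates has the degree of det^s when 22 r = 5 s; the
  least choice is r = 5, s = 22. The contradiction: let D be a translated coordinate of least
  valuation. Triangularizing multiplies g by a matrix over the valuation ring, so the coordinates
  obtained afterwards are integral combinations of those before, hence multiples of D. Five of them
  multiply to det^22, so the inverse of D^5 / det^22 lies in the ring, although this quotient should
  have positive valuation. Characteristic zero makes the Omega process succeed: the pairing of a
  power of det with itself is a positive integer.\<close>

definition nonunital_subring :: "'a::comm_ring_1 set \<Rightarrow> bool"
  where "nonunital_subring I \<longleftrightarrow> 0 \<in> I \<and> (\<forall>x\<in>I. \<forall>y\<in>I. x - y \<in> I \<and> x * y \<in> I)"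

lemma nonunital_subringI:
  assumes "0 \<in> I" "\<And>x y. x \<in> I \<Longrightarrow> y \<in> I \<Longrightarrow> x - y \<in> I" "\<And>x y. x \<in> I \<Longrightarrow> y \<in> I \<Longrightarrow> x * y \<in> I"
  shows "nonunital_subring I"
  using assms unfolding nonunital_subring_def by blast

lemma nonunital_subringD:
  assumes "nonunital_subring I"
  shows "0 \<in> I" "x \<in> I \<Longrightarrow> y \<in> I \<Longrightarrow> x - y \<in> I" "x \<in> I \<Longrightarrow> y \<in> I \<Longrightarrow> x * y \<in> I"
    "x \<in> I \<Longrightarrow> - x \<in> I" "x \<in> I \<Longrightarrow> y \<in> I \<Longrightarrow> x + y \<in> I"
proof -
  show *: "0 \<in> I" "\<And>x y. x \<in> I \<Longrightarrow> y \<in> I \<Longrightarrow> x - y \<in> I" "x \<in> I \<Longrightarrow> y \<in> I \<Longrightarrow> x * y \<in> I"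
    using assms unfolding nonunital_subring_def by blast+
  show **: "- x \<in> I" if "x \<in> I" for x
    using *(2)[OF *(1) that] by simp
  show "x \<in> I \<Longrightarrow> y \<in> I \<Longrightarrow> x + y \<in> I"
    using *(2)[of x "- y"] **[of y] by simp
qed

lemma nonunital_subring_sum:
  assumes "nonunital_subring I" "\<And>i. i \<in> A \<Longrightarrow> f i \<in> I"
  shows "sum f A \<in> I"
  using assms(2) by (induction A rule: infinite_finite_induct) (auto intro: nonunital_subringD[OF assms(1)])

text \<open>
  A variant of Chevalley's extension theorem: the multipliers \<open>Ov\<close> of a maximal non-unital subring
  \<open>I\<close> avoiding 1 form a valuation ring whose maximal ideal is \<open>I\<close>.
\<close>

locale maximal_nonunital_subring =
  fixes I :: "'a::field set"
  assumes sub: "nonunital_subring I" and one_notin: "1 \<notin> I"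
    and maximal: "\<And>J. nonunital_subring J \<Longrightarrow> I \<subseteq> J \<Longrightarrow> 1 \<notin> J \<Longrightarrow> J = I"
begin

lemmas I_zero = nonunital_subringD(1)[OF sub] and I_diff = nonunital_subringD(2)[OF sub]
  and I_mult = nonunital_subringD(3)[OF sub] and I_minus = nonunital_subringD(4)[OF sub]
  and I_add = nonunital_subringD(5)[OF sub] and I_sum = nonunital_subring_sum[OF sub]

definition Ov :: "'a set"
  where "Ov = {x. \<forall>y\<in>I. x * y \<in> I}"

lemma Ov_mult_I: "x \<in> Ov \<Longrightarrow> y \<in> I \<Longrightarrow> x * y \<in> I"
  by (auto simp: Ov_def)

lemma I_subset_Ov: "x \<in> I \<Longrightarrow> x \<in> Ov"
  by (auto simp: Ov_def I_mult)

lemma Ov_zero: "0 \<in> Ov" and Ov_one: "1 \<in> Ov"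
  by (auto simp: Ov_def I_zero)

lemma Ov_add: "x \<in> Ov \<Longrightarrow> y \<in> Ov \<Longrightarrow> x + y \<in> Ov"
  by (auto simp: Ov_def I_add distrib_right)

lemma Ov_minus: "x \<in> Ov \<Longrightarrow> - x \<in> Ov"
  by (auto simp: Ov_def I_minus)

lemma Ov_mult: "x \<in> Ov \<Longrightarrow> y \<in> Ov \<Longrightarrow> x * y \<in> Ov"
  by (auto simp: Ov_def mult.assoc)

lemma Ov_sum: "(\<And>i. i \<in> A \<Longrightarrow> f i \<in> Ov) \<Longrightarrow> sum f A \<in> Ov"
  by (induction A rule: infinite_finite_induct) (auto intro: Ov_zero Ov_add)

lemma Ov_prod: "(\<And>i. i \<in> A \<Longrightarrow> f i \<in> Ov) \<Longrightarrow> prod f A \<in> Ov"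
  by (induction A rule: infinite_finite_induct) (auto intro: Ov_one Ov_mult)

lemma Ov_power: "x \<in> Ov \<Longrightarrow> x ^ n \<in> Ov"
  by (induction n) (auto intro: Ov_one Ov_mult)

lemma one_minus_power:
  assumes "i \<in> I"
  shows "1 - (1 - i) ^ n \<in> I"
proof (induction n)
  case (Suc n)
  have "1 - (1 - i) ^ Suc n = (1 - (1 - i) ^ n) + (i - i * (1 - (1 - i) ^ n))"
    by (simp add: algebra_simps)
  also have "\<dots> \<in> I"
    by (intro I_add I_diff I_mult Suc assms)
  finally show ?case .
qed (simp add: I_zero)

lemma one_minus_power_in_Ov:
  assumes "i \<in> I"
  shows "(1 - i) ^ n \<in> Ov"
  using Ov_add[OF Ov_one Ov_minus[OF I_subset_Ov[OF one_minus_power[OF assms, of n]]]] by simp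

text \<open>Adjoin all quotients by powers of 1 - i. If 1 became such a quotient, some (1 - i)^n
  would lie in I, and with it 1; so by maximality nothing was added, and division by 1 - i preserves
  I.\<close>

lemma inverse_one_minus_in_Ov:
  assumes i: "i \<in> I"
  shows "inverse (1 - i) \<in> Ov"
proof -
  define J where "J = {j / (1 - i) ^ n | j n. j \<in> I}"
  have nz: "(1 - i) ^ n \<noteq> 0" for n
    using one_notin i by auto
  have sub_J: "nonunital_subring J"
  proof (rule nonunital_subringI)
    show "0 \<in> J" using I_zero unfolding J_def by force
  next
    fix x y assume "x \<in> J" "y \<in> J"
    then obtain j n l m where xy: "x = j / (1 - i) ^ n" "y = l / (1 - i) ^ m" "j \<in> I" "l \<in> I"
      unfolding J_def by blast
    have "x - y = ((1 - i) ^ m * j - (1 - i) ^ n * l) / (1 - i) ^ (n + m)"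
      using nz by (simp add: xy field_simps power_add)
    moreover have "(1 - i) ^ m * j - (1 - i) ^ n * l \<in> I"
      using xy one_minus_power_in_Ov[OF i] by (auto intro!: I_diff Ov_mult_I)
    ultimately show "x - y \<in> J" unfolding J_def by blast
    have "x * y = (j * l) / (1 - i) ^ (n + m)"
      by (simp add: xy power_add)
    then show "x * y \<in> J" unfolding J_def using xy I_mult by blast
  qed
  moreover have "I \<subseteq> J"
    unfolding J_def by (force intro: exI[of _ 0])
  moreover have "1 \<notin> J"
  proof
    assume "1 \<in> J"
    then obtain j n where "j \<in> I" "1 = j / (1 - i) ^ n" unfolding J_def by blast
    then have "(1 - i) ^ n \<in> I" using nz[of n] by (simp add: field_simps)
    from I_add[OF one_minus_power[OF i, of n] this] one_notin show False by simp
  qed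
  ultimately have "J = I" by (rule maximal)
  show ?thesis unfolding Ov_def
  proof safe
    fix y assume "y \<in> I"
    then have "y / (1 - i) ^ 1 \<in> J" unfolding J_def by blast
    then show "inverse (1 - i) * y \<in> I" using \<open>J = I\<close> by (simp add: field_simps)
  qed
qed

text \<open>The values at x of polynomials with coefficients in I form a non-unital subring
  containing I. If it omits 1, it equals I by maximality; as it contains x * y for y in I, x is then
  a multiplier.\<close>

lemma notin_Ov_relation:
  assumes "x \<notin> Ov"
  shows "\<exists>p. (\<forall>n. coeff p n \<in> I) \<and> poly p x = 1"
proof (rule ccontr)
  assume neg: "\<not> ?thesis"
  define J where "J = {poly p x | p. \<forall>n. coeff p n \<in> I}"
  have "nonunital_subring J"
  proof (rule nonunital_subringI)
    show "0 \<in> J" unfolding J_def using I_zero by (auto intro!: exI[of _ 0])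
  next
    fix a b assume "a \<in> J" "b \<in> J"
    then obtain p q where pq: "a = poly p x" "b = poly q x" "\<forall>n. coeff p n \<in> I" "\<forall>n. coeff q n \<in> I"
      unfolding J_def by blast
    show "a - b \<in> J" unfolding J_def using pq
      by (auto intro!: exI[of _ "p - q"] I_diff)
    show "a * b \<in> J" unfolding J_def using pq
      by (auto intro!: exI[of _ "p * q"] I_sum I_mult simp: coeff_mult)
  qed
  moreover have "I \<subseteq> J"
  proof
    fix y assume "y \<in> I"
    then show "y \<in> J" unfolding J_def
      by (auto intro!: exI[of _ "[:y:]"] simp: coeff_pCons I_zero split: nat.split)
  qed
  moreover have "1 \<notin> J" using neg unfolding J_def by fastforce
  ultimately have "J = I" by (rule maximal)
  have "x * y \<in> I" if "y \<in> I" for y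
  proof -
    have "x * y \<in> J" unfolding J_def using that I_zero
      by (auto intro!: exI[of _ "[:0, y:]"] simp: coeff_pCons split: nat.split)
    then show ?thesis using \<open>J = I\<close> by simp
  qed
  then have "x \<in> Ov" unfolding Ov_def by blast
  with assms show False by blast
qed

text \<open>The leading term of the longer relation can be eliminated with the shorter one.\<close>

lemma shorten_relation:
  assumes p: "\<And>n. coeff p n \<in> I" "poly p x = 1" and q: "\<And>n. coeff q n \<in> I" "poly q (inverse x) = 1"
    and le: "degree q \<le> degree p" and x: "x \<noteq> 0"
  shows "\<exists>r. (\<forall>n. coeff r n \<in> I) \<and> poly r x = 1 \<and> degree r < degree p"
proof -
  define n where "n = degree p"
  define m where "m = degree q"
  define a where "a = coeff p n"
  have n_pos: "n > 0"
  proof (rule ccontr)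
    assume "\<not> n > 0"
    then have "p = [:coeff p 0:]" by (metis degree_0_id neq0_conv n_def)
    then have "poly p x = coeff p 0" by (metis mult_zero_right poly_0 poly_pCons add.right_neutral)
    with p one_notin show False by metis
  qed
  \<comment> \<open>The constant term of q lies in I, so 1 minus it is a unit of \<open>Ov\<close>;
    dividing by it turns the relation for the inverse of x into one without constant term, whose
    coefficients b j are still in I.\<close>
  have unit: "1 - coeff q 0 \<noteq> 0" using q(1)[of 0] one_notin by auto
  define b where "b = (\<lambda>j. inverse (1 - coeff q 0) * coeff q j)"
  have b_I: "b j \<in> I" for j
    unfolding b_def by (intro Ov_mult_I inverse_one_minus_in_Ov q)
  have "1 = (\<Sum>j\<le>m. coeff q j * inverse x ^ j)"
    using q(2) unfolding poly_altdef m_def by simp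
  also have "\<dots> = coeff q 0 + (\<Sum>j\<in>{1..m}. coeff q j * inverse x ^ j)"
    by (simp add: atMost_atLeast0 sum.atLeast_Suc_atMost)
  finally have "1 - coeff q 0 = (\<Sum>j\<in>{1..m}. coeff q j * inverse x ^ j)" by (simp add: algebra_simps)
  then have b1: "1 = (\<Sum>j\<in>{1..m}. b j * inverse x ^ j)"
    using unit by (simp add: b_def mult.assoc sum_distrib_left[symmetric])
  \<comment> \<open>Multiplying that relation by a x^n rewrites the leading term of p by lower
    powers of x; m \<le> n keeps the exponents n - j free of truncation.\<close>
  define r where "r = (p - monom a n) + (\<Sum>j\<in>{1..m}. monom (a * b j) (n - j))"
  have "a * x ^ n = (\<Sum>j\<in>{1..m}. a * b j * x ^ (n - j))"
  proof -
    have "a * x ^ n = a * x ^ n * (\<Sum>j\<in>{1..m}. b j * inverse x ^ j)" using b1 by simp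
    also have "\<dots> = (\<Sum>j\<in>{1..m}. a * b j * (x ^ n * inverse x ^ j))"
      by (simp add: sum_distrib_left mult_ac)
    also have "\<dots> = (\<Sum>j\<in>{1..m}. a * b j * x ^ (n - j))"
      using le x by (intro sum.cong) (auto simp: m_def n_def power_diff field_simps)
    finally show ?thesis .
  qed
  then have "poly r x = 1"
    using p(2) by (simp add: r_def poly_sum poly_monom)
  moreover have "coeff r k \<in> I" for k
    unfolding r_def coeff_add coeff_diff coeff_sum coeff_monom a_def
    by (intro I_add I_diff I_sum p) (auto intro!: I_mult p b_I I_zero)
  moreover have "degree r < n"
  proof -
    have "coeff r k = 0" if "k \<ge> n" for k
    proof -
      have "coeff (p - monom a n) k = 0"
        using that by (cases "k = n") (auto simp: a_def n_def coeff_eq_0)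
      moreover have "coeff (monom (a * b j) (n - j)) k = 0" if "j \<in> {1..m}" for j
        using that \<open>k \<ge> n\<close> n_pos by auto
      ultimately show ?thesis unfolding r_def by (simp add: coeff_sum)
    qed
    then show ?thesis using n_pos by (intro degree_lessI) auto
  qed
  ultimately show ?thesis unfolding n_def by blast
qed

text \<open>If both failed, x and its inverse would each satisfy a relation with coefficients in I.
  Of two such relations of least degree, the longer one can be shortened by the other.\<close>

lemma Ov_valuation: "x \<in> Ov \<or> inverse x \<in> Ov"
proof (rule ccontr)
  assume neg: "\<not> ?thesis"
  then have x: "x \<noteq> 0" using Ov_zero by auto
  define P where "P y n \<longleftrightarrow> (\<exists>p. (\<forall>n. coeff p n \<in> I) \<and> poly p y = 1 \<and> degree p = n)" for y n
  have ex: "\<exists>n. P x n" "\<exists>n. P (inverse x) n"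
    using notin_Ov_relation neg unfolding P_def by blast+
  define n m where "n = (LEAST n. P x n)" and "m = (LEAST n. P (inverse x) n)"
  have "P x n" "P (inverse x) m" unfolding n_def m_def using ex by (metis LeastI)+
  then obtain p q where p: "\<forall>n. coeff p n \<in> I" "poly p x = 1" "degree p = n"
    and q: "\<forall>n. coeff q n \<in> I" "poly q (inverse x) = 1" "degree q = m" unfolding P_def by blast
  show False
  proof (cases "m \<le> n")
    case True
    then obtain r where "\<forall>n. coeff r n \<in> I" "poly r x = 1" "degree r < n"
      using shorten_relation[of p x q] p q x by auto
    then show False using not_less_Least[of "degree r" "P x"] unfolding n_def P_def by blast
  next
    case False
    then obtain r where "\<forall>n. coeff r n \<in> I" "poly r (inverse x) = 1" "degree r < m"
      using shorten_relation[of q "inverse x" p] p q x by auto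
    then show False using not_less_Least[of "degree r" "P (inverse x)"] unfolding m_def P_def by blast
  qed
qed

lemma Ov_divides_total: "(\<exists>c\<in>Ov. y = c * x) \<or> (\<exists>c\<in>Ov. x = c * y)"
proof (cases "x = 0 \<or> y = 0")
  case True
  then show ?thesis using Ov_zero by auto
next
  case False
  then show ?thesis using Ov_valuation[of "y / x"]
    by (auto intro: bexI[of _ "y / x"] bexI[of _ "inverse (y / x)"])
qed

text \<open>Provides an element of least valuation; divisibility by members of \<open>Ov\<close>
  replaces the value group, which is never formed.\<close>

lemma Ov_minimum:
  assumes "finite A" "A \<noteq> {}"
  shows "\<exists>a\<in>A. \<forall>b\<in>A. \<exists>c\<in>Ov. f b = c * f a"
  using assms
proof (induction A rule: finite_ne_induct)
  case (singleton x)
  then show ?case using Ov_one by (auto intro: bexI[of _ 1])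
next
  case (insert x A)
  then obtain a where a: "a \<in> A" "\<And>b. b \<in> A \<Longrightarrow> \<exists>c\<in>Ov. f b = c * f a" by blast
  show ?case
  proof (cases "\<exists>c\<in>Ov. f x = c * f a")
    case True
    then show ?thesis using a by blast
  next
    case False
    then obtain c where c: "c \<in> Ov" "f a = c * f x" using Ov_divides_total[of "f x" "f a"] by blast
    have "\<exists>d\<in>Ov. f b = d * f x" if b: "b \<in> insert x A" for b
    proof (cases "b = x")
      case True
      then show ?thesis using Ov_one by (auto intro: bexI[of _ 1])
    next
      case False
      then obtain d where d: "d \<in> Ov" "f b = d * f a" using a(2)[of b] b by blast
      show ?thesis
      proof (rule bexI)
        show "f b = (d * c) * f x" by (simp only: d(2) c(2) mult.assoc)
        show "d * c \<in> Ov" by (intro Ov_mult c d)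
      qed
    qed
    then show ?thesis by blast
  qed
qed

lemma Ov_matrix_mult:
  fixes A B :: "'a ^ 'n::finite ^ 'n"
  assumes "\<And>i j. A $ i $ j \<in> Ov" "\<And>i j. B $ i $ j \<in> Ov"
  shows "(A ** B) $ i $ j \<in> Ov"
  using assms by (auto simp: matrix_matrix_mult_def intro!: Ov_sum Ov_mult)

text \<open>Gaussian elimination with pivots of minimal valuation needs only row operations over the
  valuation ring: this is the Iwasawa decomposition.\<close>

lemma triangularize_over_Ov:
  fixes Y :: "(('a, 'n::{finite, wellorder}) vec, 'n) vec"
  shows "\<exists>A :: (('a, 'n) vec, 'n) vec. (\<forall>i j. A $ i $ j \<in> Ov) \<and> det (A ** Y) ^ 2 = det Y ^ 2 \<and>
    (\<forall>j\<in>S. \<forall>i>j. (A ** Y) $ i $ j = 0)"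
proof -
  have "finite S" by simp
  then show ?thesis
  \<comment> \<open>Columns are treated in increasing order: all columns of S lie to the left of b
    and already vanish below the diagonal, which operations among the rows from b downward
    preserve.\<close>
  proof (induction S rule: finite_linorder_max_induct)
    case empty
    show ?case by (rule exI[of _ "mat 1"]) (simp, simp add: mat_def Ov_zero Ov_one)
  next
    case (insert b S)
    then obtain A :: "(('a, 'n) vec, 'n) vec" where A: "\<And>i j. A $ i $ j \<in> Ov" "det (A ** Y) ^ 2 = det Y ^ 2"
      "\<And>i j. j \<in> S \<Longrightarrow> i > j \<Longrightarrow> (A ** Y) $ i $ j = 0" by blast
    define Z where "Z = A ** Y"
    obtain a where a: "a \<ge> b" "\<And>i. i \<ge> b \<Longrightarrow> \<exists>c\<in>Ov. Z $ i $ b = c * Z $ a $ b"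
      using Ov_minimum[of "{b..}" "\<lambda>i. Z $ i $ b"] by auto
    define p where "p = Transposition.transpose a b"
    have p: "p permutes UNIV" unfolding p_def by (simp add: permutes_swap_id)
    define Q :: "(('a, 'n) vec, 'n) vec" where "Q = (\<chi> i. (mat 1 :: (('a, 'n) vec, 'n) vec) $ p i)"
    have Q_mult: "Q ** M = (\<chi> i. M $ p i)" for M :: "(('a, 'n) vec, 'n) vec"
      unfolding Q_def by (simp add: vec_eq_iff matrix_matrix_mult_def mat_def if_distrib [of "\<lambda>x. x * _"] cong: if_cong)
    define W where "W = Q ** Z"
    \<comment> \<open>Exchanging two rows costs a sign; this is why only the square of the
      determinant is tracked.\<close>
    have det_W: "det W ^ 2 = det Z ^ 2"
      unfolding W_def Q_mult det_permute_rows[OF p]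
      by (simp add: power_mult_distrib sign_def)
    have W_entry: "W $ i $ j = Z $ p i $ j" for i j unfolding W_def Q_mult by simp
    have W_S: "W $ i $ j = 0" if "j \<in> S" "i \<ge> b" for i j
    proof -
      have "j < b" using insert.hyps that by blast
      then have "j < p i" using a(1) that(2) by (auto simp: p_def Transposition.transpose_def)
      then show ?thesis unfolding W_entry Z_def using A(3) that by blast
    qed
    have "\<exists>c\<in>Ov. W $ i $ b = c * W $ b $ b" if "i \<ge> b" for i
    proof -
      have "p i \<ge> b" using a(1) that by (auto simp: p_def Transposition.transpose_def)
      moreover have "p b = a" unfolding p_def by simp
      ultimately show ?thesis unfolding W_entry using a(2) by simp
    qed
    then obtain c where c: "\<And>i. i \<ge> b \<Longrightarrow> c i \<in> Ov" "\<And>i. i \<ge> b \<Longrightarrow> W $ i $ b = c i * W $ b $ b"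
      by metis
    define E :: "(('a, 'n) vec, 'n) vec" where "E = (\<chi> i j. if i = j then 1 else if j = b \<and> i > b then - c i else 0)"
    have E_mult: "(E ** W) $ i $ j = (if i > b then W $ i $ j - c i * W $ b $ j else W $ i $ j)" for i j
    proof -
      have "(E ** W) $ i $ j = (\<Sum>k\<in>UNIV. (if i = k then W $ k $ j else 0)
          + (if k = b then (if i > b then - c i * W $ b $ j else 0) else 0))"
        unfolding E_def matrix_matrix_mult_def vec_lambda_beta by (intro sum.cong refl) auto
      then show ?thesis by (simp add: sum.distrib)
    qed
    have "det E = 1"
      by (subst det_lowerdiagonal) (auto simp: E_def)
    have eq: "(E ** (Q ** A)) ** Y = E ** W"
      unfolding W_def Z_def by (simp add: matrix_mul_assoc)
    show ?case
    proof (rule exI[of _ "E ** (Q ** A)"], intro conjI allI ballI impI)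
      fix i j
      show "(E ** (Q ** A)) $ i $ j \<in> Ov"
      proof (intro Ov_matrix_mult)
        show "E $ i $ j \<in> Ov" for i j
          by (auto simp: E_def intro!: Ov_zero Ov_one Ov_minus c)
        show "Q $ i $ j \<in> Ov" for i j
          by (auto simp: Q_def mat_def intro!: Ov_zero Ov_one)
      qed (rule A)
    next
      show "det (E ** (Q ** A) ** Y) ^ 2 = det Y ^ 2"
        unfolding eq det_mul \<open>det E = 1\<close> using det_W A(2) by (simp add: Z_def)
    next
      fix i j assume j: "j \<in> insert b S" "j < i"
      show "(E ** (Q ** A) ** Y) $ i $ j = 0"
      proof (cases "j = b")
        case True
        then show ?thesis unfolding eq E_mult using j c(2)[of i] by auto
      next
        case False
        then have "j \<in> S" "j < b" using j insert.hyps by auto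
        have "W $ i $ j = 0" if "\<not> i \<ge> b"
          using that A(3)[OF \<open>j \<in> S\<close> j(2)] a(1) unfolding W_entry Z_def
          by (auto simp: p_def Transposition.transpose_def)
        then show ?thesis unfolding eq E_mult using W_S[OF \<open>j \<in> S\<close>] by force
      qed
    qed
  qed
qed

end

lemma maximal_nonunital_subring_exists:
  fixes J :: "'a::field set"
  assumes J: "nonunital_subring J" "1 \<notin> J"
  shows "\<exists>I. J \<subseteq> I \<and> maximal_nonunital_subring I"
proof -
  define \<A> where "\<A> = {I. nonunital_subring I \<and> 1 \<notin> I \<and> J \<subseteq> I}"
  have "\<exists>U\<in>\<A>. \<forall>X\<in>C. X \<subseteq> U" if C: "subset.chain \<A> C" for C
  proof (cases "C = {}")
    case True
    then show ?thesis using J unfolding \<A>_def by blast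
  next
    case False
    have CA: "C \<subseteq> \<A>" and tot: "\<And>X Y. X \<in> C \<Longrightarrow> Y \<in> C \<Longrightarrow> X \<subseteq> Y \<or> Y \<subseteq> X"
      using C by (auto simp: subset.chain_def)
    have "nonunital_subring (\<Union>C)"
    proof (rule nonunital_subringI)
      show "0 \<in> \<Union>C" using False CA nonunital_subringD(1) unfolding \<A>_def by blast
    next
      fix x y assume "x \<in> \<Union>C" "y \<in> \<Union>C"
      then obtain X where "X \<in> C" "x \<in> X" "y \<in> X" using tot by blast
      moreover have "nonunital_subring X" using CA \<open>X \<in> C\<close> unfolding \<A>_def by blast
      ultimately show "x - y \<in> \<Union>C" "x * y \<in> \<Union>C" using nonunital_subringD(2,3) by blast+
    qed
    then have "\<Union>C \<in> \<A>" using CA False unfolding \<A>_def by blast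
    then show ?thesis by blast
  qed
  from subset_Zorn[OF this] obtain M where M: "M \<in> \<A>" "\<And>X. X \<in> \<A> \<Longrightarrow> M \<subseteq> X \<Longrightarrow> X = M" by blast
  then have "maximal_nonunital_subring M"
    by unfold_locales (auto simp: \<A>_def)
  then show ?thesis using M(1) unfolding \<A>_def by blast
qed


subsection \<open>Substitution into polynomials\<close>

lemma mpoly_induct_single [case_names single add]:
  fixes p :: "('k::comm_ring_1, 'n) mpoly"
  assumes single: "\<And>m c. P (Poly_Mapping.single m c)" and add: "\<And>p q. P p \<Longrightarrow> P q \<Longrightarrow> P (p + q)"
  shows "P p"
proof -
  have sum: "P (\<Sum>m\<in>A. Poly_Mapping.single m (c m))" for A and c :: "_ \<Rightarrow> 'k"
    using single[of 0 0] by (induction A rule: infinite_finite_induct) (auto intro: single add)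
  have "p = (\<Sum>m\<in>Poly_Mapping.keys p. Poly_Mapping.single m (Poly_Mapping.lookup p m))"
    by (rule poly_mapping_eqI)
      (auto simp: lookup_sum lookup_single when_def in_keys_iff)
  then show ?thesis using sum by metis
qed

lemma single_as_var_mult:
  assumes "Poly_Mapping.lookup m i > 0"
  shows "Poly_Mapping.single m c = mvar i * Poly_Mapping.single (m - Poly_Mapping.single i 1) (c :: 'k::comm_ring_1)"
proof -
  have "m = Poly_Mapping.single i 1 + (m - Poly_Mapping.single i 1)"
    using assms by (intro poly_mapping_eqI) (auto simp: lookup_add lookup_minus lookup_single when_def)
  then show ?thesis unfolding mvar_def mult_single by simp
qed

lemma mpoly_induct_var [case_names const add var]:
  fixes p :: "('k::comm_ring_1, 'n::finite) mpoly"
  assumes const: "\<And>c. P (mconst c)" and add: "\<And>p q. P p \<Longrightarrow> P q \<Longrightarrow> P (p + q)"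
    and var: "\<And>i p. P p \<Longrightarrow> P (mvar i * p)"
  shows "P p"
proof (induction p rule: mpoly_induct_single)
  case (single m c)
  show ?case
  proof (induction "\<Sum>i\<in>UNIV. Poly_Mapping.lookup m i" arbitrary: m)
    case 0
    then have "m = 0" by (intro poly_mapping_eqI) auto
    then show ?case using const[of c] by (simp add: mconst_def)
  next
    case (Suc d)
    then obtain i where i: "Poly_Mapping.lookup m i > 0"
      by (metis neq0_conv sum.neutral nat.distinct(1))
    have "Suc d = Poly_Mapping.lookup m i + (\<Sum>j\<in>UNIV - {i}. Poly_Mapping.lookup m j)"
      using Suc.hyps(2) by (simp add: sum.remove[of _ i])
    moreover have "(\<Sum>j\<in>UNIV. Poly_Mapping.lookup (m - Poly_Mapping.single i 1) j) =
        Poly_Mapping.lookup m i - 1 + (\<Sum>j\<in>UNIV - {i}. Poly_Mapping.lookup m j)"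
      by (subst sum.remove[of _ i]) (auto simp: lookup_minus lookup_single when_def intro!: sum.cong)
    ultimately have "d = (\<Sum>j\<in>UNIV. Poly_Mapping.lookup (m - Poly_Mapping.single i 1) j)"
      using i by simp
    from Suc.hyps(1)[OF this] show ?case
      using var single_as_var_mult[OF i, of c] by metis
  qed
qed (rule add)

lemma mconst_0 [simp]: "mconst 0 = 0" and mconst_1 [simp]: "mconst 1 = 1"
  and mconst_add: "mconst (a + b) = mconst a + mconst b"
  and mconst_mult: "mconst (a * b) = mconst a * mconst b"
  by (simp_all add: mconst_def single_add mult_single)

lemma lookup_mconst_mult [simp]: "Poly_Mapping.lookup (mconst c * p) m = c * Poly_Mapping.lookup p m"
  by (induction p rule: mpoly_induct_single)
    (auto simp: mconst_def mult_single lookup_single when_def lookup_add distrib_left)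

lemma lookup_mult_mconst [simp]: "Poly_Mapping.lookup (p * mconst c) m = c * Poly_Mapping.lookup p m"
  by (simp add: mult.commute[of p])

lemma mconst_sum: "mconst (sum f A) = (\<Sum>x\<in>A. mconst (f x))"
  by (induction A rule: infinite_finite_induct) (auto simp: mconst_add)

lemma mconst_prod: "mconst (prod f A) = (\<Prod>x\<in>A. mconst (f x))"
  by (induction A rule: infinite_finite_induct) (auto simp: mconst_mult)

text \<open>Common form of \<open>meval\<close>, \<open>linsub\<close> and \<open>along\<close>: C
  maps the coefficients, x gives the images of the variables. For C a ring homomorphism the result
  is again one, so the facts of \<open>coeff_hom\<close>, in particular commutation with
  determinants, apply to every substitution.\<close>

definition mpoly_subst :: "('k::comm_ring_1 \<Rightarrow> 'r::comm_ring_1) \<Rightarrow> ('n::finite \<Rightarrow> 'r) \<Rightarrow> ('k, 'n) mpoly \<Rightarrow> 'r"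
  where "mpoly_subst C x p =
    (\<Sum>m\<in>Poly_Mapping.keys p. C (Poly_Mapping.lookup p m) * (\<Prod>i\<in>UNIV. x i ^ Poly_Mapping.lookup m i))"

locale coeff_hom =
  fixes C :: "'k::comm_ring_1 \<Rightarrow> 'r::comm_ring_1"
  assumes C_add: "C (a + b) = C a + C b" and C_mult: "C (a * b) = C a * C b" and C_1 [simp]: "C 1 = 1"
begin

lemma C_0 [simp]: "C 0 = 0"
  using C_add[of 0 0] by simp

lemma C_uminus: "C (- a) = - C a"
  using C_add[of a "- a"] by (simp add: eq_neg_iff_add_eq_0 add.commute)

lemma C_diff: "C (a - b) = C a - C b"
  using C_add[of a "- b"] by (simp add: C_uminus)

lemma C_sum: "C (sum f A) = (\<Sum>x\<in>A. C (f x))"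
  by (induction A rule: infinite_finite_induct) (auto simp: C_add)

lemma C_prod: "C (prod f A) = (\<Prod>x\<in>A. C (f x))"
  by (induction A rule: infinite_finite_induct) (auto simp: C_mult)

lemma C_power: "C (a ^ n) = C a ^ n"
  by (induction n) (auto simp: C_mult)

lemma C_of_nat: "C (of_nat n) = of_nat n"
  by (induction n) (auto simp: C_add)

lemma C_of_int: "C (of_int n) = of_int n"
  by (cases n rule: int_cases2) (auto simp: C_of_nat C_uminus)

lemma C_det: "C (det A) = det (\<chi> i j. C (A $ i $ j))"
  unfolding det_def C_sum C_mult C_prod C_of_int by simp

lemma mpoly_subst_superset:
  assumes "finite A" "Poly_Mapping.keys p \<subseteq> A"
  shows "mpoly_subst C x p = (\<Sum>m\<in>A. C (Poly_Mapping.lookup p m) * (\<Prod>i\<in>UNIV. x i ^ Poly_Mapping.lookup m i))"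
  unfolding mpoly_subst_def using assms
  by (intro sum.mono_neutral_left) (auto simp: in_keys_iff)

lemma mpoly_subst_add: "mpoly_subst C x (p + q) = mpoly_subst C x p + mpoly_subst C x q"
proof -
  let ?A = "Poly_Mapping.keys p \<union> Poly_Mapping.keys q"
  have "Poly_Mapping.keys (p + q) \<subseteq> ?A" by (rule keys_add)
  then show ?thesis
    by (simp add: mpoly_subst_superset[of ?A] lookup_add C_add distrib_right sum.distrib)
qed

lemma mpoly_subst_single:
  "mpoly_subst C x (Poly_Mapping.single m c) = C c * (\<Prod>i\<in>UNIV. x i ^ Poly_Mapping.lookup m i)"
  by (subst mpoly_subst_superset[of "{m}"]) auto

lemma mpoly_subst_mult: "mpoly_subst C x (p * q) = mpoly_subst C x p * mpoly_subst C x q"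
proof (induction p rule: mpoly_induct_single)
  case (single m c)
  show ?case
  proof (induction q rule: mpoly_induct_single)
    case (single m' c')
    then show ?case
      by (simp add: mult_single mpoly_subst_single C_mult lookup_add power_add prod.distrib mult_ac)
  qed (simp add: mpoly_subst_add algebra_simps)
qed (simp add: mpoly_subst_add algebra_simps)

lemma mpoly_subst_mconst: "mpoly_subst C x (mconst c) = C c"
  unfolding mconst_def mpoly_subst_single by simp

lemma mpoly_subst_mvar: "mpoly_subst C x (mvar i) = x i"
proof -
  have "(\<Prod>j\<in>UNIV. x j ^ Poly_Mapping.lookup (Poly_Mapping.single i 1) j) = (\<Prod>j\<in>UNIV. if j = i then x j else 1)"
    by (intro prod.cong) (auto simp: lookup_single when_def)
  then show ?thesis unfolding mvar_def mpoly_subst_single by simp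
qed

lemma coeff_hom_mpoly_subst: "coeff_hom (mpoly_subst C x)"
  by unfold_locales (auto simp: mpoly_subst_add mpoly_subst_mult mpoly_subst_mconst simp flip: mconst_1)

end

lemma coeff_hom_mconst: "coeff_hom mconst"
  by unfold_locales (auto simp: mconst_add mconst_mult)

lemma coeff_hom_id: "coeff_hom (\<lambda>x. x)"
  by unfold_locales auto

interpretation mconst: coeff_hom mconst by (rule coeff_hom_mconst)

interpretation lin: coeff_hom "mpoly_subst mconst x" for x
  by (rule mconst.coeff_hom_mpoly_subst)

interpretation meval: coeff_hom "mpoly_subst (\<lambda>x. x) x" for x
  by (rule coeff_hom.coeff_hom_mpoly_subst[OF coeff_hom_id])

lemma meval_conv_subst: "meval p v = mpoly_subst (\<lambda>x. x) (\<lambda>i. v $ i) p"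
  unfolding meval_def mpoly_subst_def ..


subsection \<open>The apolar pairing\<close>

text \<open>This is p(d/dx) applied to q and evaluated at 0: distinct monomials are orthogonal, and
  a monomial pairs with itself to the product of the factorials of its exponents.\<close>

definition apolar :: "('k::comm_ring_1, 'n::finite) mpoly \<Rightarrow> ('k, 'n) mpoly \<Rightarrow> 'k"
  where "apolar p q = (\<Sum>m\<in>Poly_Mapping.keys p. Poly_Mapping.lookup p m * Poly_Mapping.lookup q m *
    (\<Prod>i\<in>UNIV. of_nat (fact (Poly_Mapping.lookup m i))))"

lemma apolar_superset:
  assumes "finite A" "Poly_Mapping.keys p \<subseteq> A"
  shows "apolar p q = (\<Sum>m\<in>A. Poly_Mapping.lookup p m * Poly_Mapping.lookup q m *
    (\<Prod>i\<in>UNIV. of_nat (fact (Poly_Mapping.lookup m i))))"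
  unfolding apolar_def using assms by (intro sum.mono_neutral_left) (auto simp: in_keys_iff)

lemma apolar_add_left: "apolar (p + q) r = apolar p r + apolar q r"
proof -
  let ?A = "Poly_Mapping.keys p \<union> Poly_Mapping.keys q"
  have "Poly_Mapping.keys (p + q) \<subseteq> ?A" by (rule keys_add)
  then show ?thesis
    by (simp add: apolar_superset[of ?A] lookup_add distrib_right sum.distrib)
qed

lemma apolar_add_right: "apolar r (p + q) = apolar r p + apolar r q"
  by (simp add: apolar_def lookup_add algebra_simps sum.distrib)

lemma apolar_mconst_left: "apolar (mconst c * p) q = c * apolar p q"
proof -
  have "Poly_Mapping.keys (mconst c * p) \<subseteq> Poly_Mapping.keys p" by (auto simp: in_keys_iff)
  then show ?thesis
    by (simp add: apolar_superset[of "Poly_Mapping.keys p"] sum_distrib_left mult_ac)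
qed

lemma apolar_mconst_right: "apolar p (mconst c * q) = c * apolar p q"
  by (simp add: apolar_def sum_distrib_left mult_ac)

lemma apolar_0_left [simp]: "apolar 0 q = 0" and apolar_0_right [simp]: "apolar p 0 = 0"
  by (simp_all add: apolar_def)

lemma apolar_sum_left: "apolar (sum f A) q = (\<Sum>x\<in>A. apolar (f x) q)"
  by (induction A rule: infinite_finite_induct) (auto simp: apolar_add_left)

lemma apolar_sum_right: "apolar q (sum f A) = (\<Sum>x\<in>A. apolar q (f x))"
  by (induction A rule: infinite_finite_induct) (auto simp: apolar_add_right)

lemma apolar_diff_left: "apolar (p - q) r = apolar p r - apolar q r"
  using apolar_add_left[of "p - q" q r] by simp

lemma apolar_single:
  "apolar (Poly_Mapping.single m c) q = c * Poly_Mapping.lookup q m * (\<Prod>i\<in>UNIV. of_nat (fact (Poly_Mapping.lookup m i)))"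
  by (subst apolar_superset[of "{m}"]) auto

lemma lookup_mvar_mult:
  "Poly_Mapping.lookup (mvar i * p) m =
    (if Poly_Mapping.lookup m i = 0 then 0 else Poly_Mapping.lookup p (m - Poly_Mapping.single i 1))"
proof (induction p rule: mpoly_induct_single)
  case (single m' c)
  have "Poly_Mapping.single i 1 + m' = m \<longleftrightarrow> Poly_Mapping.lookup m i \<noteq> 0 \<and> m' = m - Poly_Mapping.single i 1"
    by (auto simp: poly_mapping_eq_iff fun_eq_iff lookup_add lookup_minus lookup_single when_def)
  then show ?case by (auto simp: mvar_def mult_single lookup_single when_def)
qed (auto simp: distrib_left lookup_add)

text \<open>The formal partial derivative, given by its coefficients; this makes its adjointness to
  multiplication by \<open>mvar v\<close> under \<open>apolar\<close> a comparison of
  factorials.\<close>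

definition mderiv :: "'n \<Rightarrow> ('k::comm_ring_1, 'n::finite) mpoly \<Rightarrow> ('k, 'n) mpoly"
  where "mderiv v p = Abs_poly_mapping
    (\<lambda>m. of_nat (Suc (Poly_Mapping.lookup m v)) * Poly_Mapping.lookup p (m + Poly_Mapping.single v 1))"

lemma lookup_mderiv:
  "Poly_Mapping.lookup (mderiv v p) m =
    of_nat (Suc (Poly_Mapping.lookup m v)) * Poly_Mapping.lookup p (m + Poly_Mapping.single v 1)"
proof -
  have "finite ((\<lambda>m. m + Poly_Mapping.single v 1) -` Poly_Mapping.keys p)"
    by (rule finite_vimageI) (auto intro: injI)
  then have "finite {m. of_nat (Suc (Poly_Mapping.lookup m v)) * Poly_Mapping.lookup p (m + Poly_Mapping.single v 1) \<noteq> 0}"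
    by (rule finite_subset[rotated]) (auto simp: in_keys_iff)
  then show ?thesis unfolding mderiv_def by (subst lookup_Abs_poly_mapping) auto
qed

lemma mderiv_add: "mderiv v (p + q) = mderiv v p + mderiv v q"
  by (rule poly_mapping_eqI) (simp add: lookup_mderiv lookup_add algebra_simps)

lemma mderiv_mconst_mult: "mderiv v (mconst c * p) = mconst c * mderiv v p"
  by (rule poly_mapping_eqI) (simp add: lookup_mderiv mult_ac)

lemma mderiv_0 [simp]: "mderiv v 0 = 0"
  by (rule poly_mapping_eqI) (simp add: lookup_mderiv)

lemma mderiv_sum: "mderiv v (sum f A) = (\<Sum>x\<in>A. mderiv v (f x))"
  by (induction A rule: infinite_finite_induct) (auto simp: mderiv_add)

lemma mderiv_mconst [simp]: "mderiv v (mconst c) = 0"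
proof (rule poly_mapping_eqI)
  fix m :: "'a \<Rightarrow>\<^sub>0 nat"
  have "m + Poly_Mapping.single v 1 \<noteq> 0"
  proof
    assume "m + Poly_Mapping.single v 1 = 0"
    then have "Poly_Mapping.lookup (m + Poly_Mapping.single v 1) v = 0" by simp
    then show False by (simp add: lookup_add)
  qed
  then show "Poly_Mapping.lookup (mderiv v (mconst c)) m = Poly_Mapping.lookup 0 m"
    by (simp add: lookup_mderiv mconst_def lookup_single when_def)
qed

lemma mderiv_mvar_mult:
  "mderiv v (mvar u * p) = (if u = v then p else 0) + mvar u * mderiv v p"
proof (rule poly_mapping_eqI)
  fix m :: "'a \<Rightarrow>\<^sub>0 nat"
  have *: "m + Poly_Mapping.single v 1 - Poly_Mapping.single u 1 = m - Poly_Mapping.single u 1 + Poly_Mapping.single v 1"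
    if "Poly_Mapping.lookup m u \<noteq> 0"
    using that by (intro poly_mapping_eqI) (auto simp: lookup_add lookup_minus lookup_single when_def)
  show "Poly_Mapping.lookup (mderiv v (mvar u * p)) m =
      Poly_Mapping.lookup ((if u = v then p else 0) + mvar u * mderiv v p) m"
    unfolding lookup_mderiv lookup_add lookup_mvar_mult using *
    by (cases "Poly_Mapping.lookup m u = 0"; cases "u = v")
      (auto simp: lookup_mderiv lookup_add lookup_mvar_mult lookup_minus lookup_single when_def distrib_right)
qed

lemma apolar_mvar: "apolar (mvar v * p) q = apolar p (mderiv v q)"
proof (induction p rule: mpoly_induct_single)
  case (single m c)
  have "(\<Prod>i\<in>UNIV. of_nat (fact (Poly_Mapping.lookup (Poly_Mapping.single v 1 + m) i)) :: 'a) =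
     of_nat (Suc (Poly_Mapping.lookup m v)) * (\<Prod>i\<in>UNIV. of_nat (fact (Poly_Mapping.lookup m i)))"
  proof -
    have "(\<Prod>i\<in>UNIV - {v}. of_nat (fact (Poly_Mapping.lookup (Poly_Mapping.single v 1 + m) i)) :: 'a) =
       (\<Prod>i\<in>UNIV - {v}. of_nat (fact (Poly_Mapping.lookup m i)))"
      by (intro prod.cong) (auto simp: lookup_add lookup_single when_def)
    then show ?thesis
      by (simp add: prod.remove[of _ v] lookup_add algebra_simps)
  qed
  then show ?case
    by (simp add: mvar_def mult_single apolar_single lookup_mderiv add.commute mult_ac)
qed (simp add: distrib_left apolar_add_left)

text \<open>The matrix is kept as a function, so that transposing is exchanging the two arguments.
  The variables will be the entries of a generic matrix.\<close>

definition linsub :: "('n \<Rightarrow> 'n \<Rightarrow> 'k) \<Rightarrow> ('k::comm_ring_1, 'n::finite) mpoly \<Rightarrow> ('k, 'n) mpoly"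
  where "linsub H = mpoly_subst mconst (\<lambda>v. \<Sum>u\<in>UNIV. mscale (H u v) (mvar u))"

lemma lin_change_conv_linsub: "lin_change g = linsub (\<lambda>u v. g $ u $ v)"
  by (simp add: fun_eq_iff lin_change_def linsub_def mpoly_subst_def)

lemma linsub_mconst [simp]: "linsub H (mconst c) = mconst c"
  and linsub_add: "linsub H (p + q) = linsub H p + linsub H q"
  and linsub_mult: "linsub H (p * q) = linsub H p * linsub H q"
  and linsub_mvar: "linsub H (mvar v) = (\<Sum>u\<in>UNIV. mconst (H u v) * mvar u)"
  by (simp_all add: linsub_def mconst.mpoly_subst_mconst mconst.mpoly_subst_mvar lin.C_add lin.C_mult mscale_def)

lemma mderiv_linear_mult:
  "mderiv v ((\<Sum>u\<in>UNIV. mconst (h u) * mvar u) * p) =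
    mconst (h v) * p + (\<Sum>u\<in>UNIV. mconst (h u) * mvar u) * mderiv v p"
proof -
  have "mderiv v ((\<Sum>u\<in>UNIV. mconst (h u) * mvar u) * p) =
      (\<Sum>u\<in>UNIV. mconst (h u) * mderiv v (mvar u * p))"
    by (simp add: sum_distrib_right mderiv_sum mult.assoc mderiv_mconst_mult)
  also have "\<dots> = (\<Sum>u\<in>UNIV. (if u = v then mconst (h u) * p else 0) + mconst (h u) * mvar u * mderiv v p)"
    by (intro sum.cong) (auto simp: mderiv_mvar_mult distrib_left mult.assoc)
  also have "\<dots> = mconst (h v) * p + (\<Sum>u\<in>UNIV. mconst (h u) * mvar u) * mderiv v p"
    by (simp add: sum.distrib sum_distrib_right)
  finally show ?thesis .
qed

text \<open>The chain rule, which lets adjointness pass from a variable to a linear form.\<close>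

lemma mderiv_linsub:
  "mderiv v (linsub H q) = (\<Sum>u\<in>UNIV. mconst (H v u) * linsub H (mderiv u q))"
proof (induction q rule: mpoly_induct_var)
  case (const c)
  have "linsub H 0 = 0" using linsub_mconst[of H 0] by simp
  then show ?case by simp
next
  case (add p q)
  then show ?case by (simp add: linsub_add mderiv_add distrib_left sum.distrib)
next
  case (var i q)
  have "linsub H 0 = 0" using linsub_mconst[of H 0] by simp
  then have "(\<Sum>u\<in>UNIV. mconst (H v u) * linsub H (mderiv u (mvar i * q))) =
      (\<Sum>u\<in>UNIV. (if u = i then mconst (H v u) * linsub H q else 0) +
         linsub H (mvar i) * (mconst (H v u) * linsub H (mderiv u q)))"
    by (intro sum.cong refl, subst mderiv_mvar_mult) (auto simp: linsub_add linsub_mult distrib_left mult_ac)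
  also have "\<dots> = mconst (H v i) * linsub H q + linsub H (mvar i) * mderiv v (linsub H q)"
    by (simp add: sum.distrib var sum_distrib_left)
  also have "\<dots> = mderiv v (linsub H (mvar i * q))"
    by (simp add: linsub_mult linsub_mvar mderiv_linear_mult)
  finally show ?case by simp
qed

lemma lookup_linsub_0: "Poly_Mapping.lookup (linsub H q) 0 = Poly_Mapping.lookup q 0"
proof (induction q rule: mpoly_induct_var)
  case (var i p)
  then show ?case
    by (simp add: linsub_mult linsub_mvar sum_distrib_right lookup_sum mult.assoc lookup_mvar_mult)
qed (simp_all add: linsub_add lookup_add)

text \<open>Multiplication by a variable is adjoint to differentiation: each variable split off from
  p becomes a derivative of q, which the chain rule moves through the substitution. Hence a
  substitution is adjoint to its transpose.\<close>

lemma apolar_linsub: "apolar (linsub H p) q = apolar p (linsub (\<lambda>u v. H v u) q)"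
proof (induction p arbitrary: q rule: mpoly_induct_var)
  case (const c)
  have "apolar (mconst c) q = c * Poly_Mapping.lookup q 0" for q :: "('a, 'b) mpoly"
    by (simp add: mconst_def apolar_single)
  then show ?case by (simp add: lookup_linsub_0)
next
  case (add p q)
  then show ?case by (simp add: linsub_add apolar_add_left)
next
  case (var i p)
  have "apolar (linsub H (mvar i * p)) q = (\<Sum>u\<in>UNIV. H u i * apolar (linsub H p) (mderiv u q))"
    by (simp add: linsub_mult linsub_mvar sum_distrib_right apolar_sum_left mult.assoc apolar_mconst_left apolar_mvar)
  also have "\<dots> = apolar (mvar i * p) (linsub (\<lambda>u v. H v u) q)"
    by (simp add: var apolar_mvar mderiv_linsub apolar_sum_right apolar_mconst_right)
  finally show ?case .
qed

section \<open>Nonvanishing of the pairing on integral polynomials\<close>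

definition integral_coeffs :: "('k::comm_ring_1, 'n) mpoly set"
  where "integral_coeffs = {p. \<forall>m. Poly_Mapping.lookup p m \<in> \<int>}"

lemma integral_coeffs_add: "p \<in> integral_coeffs \<Longrightarrow> q \<in> integral_coeffs \<Longrightarrow> p + q \<in> integral_coeffs"
  by (auto simp: integral_coeffs_def lookup_add)

lemma integral_coeffs_mult:
  fixes p q :: "('k::comm_ring_1, 'n) mpoly"
  assumes "p \<in> integral_coeffs" "q \<in> integral_coeffs"
  shows "p * q \<in> integral_coeffs"
proof -
  have "Sum_any f \<in> \<int>" if "\<And>k. f k \<in> \<int>" for f :: "('n \<Rightarrow>\<^sub>0 nat) \<Rightarrow> 'k"
    unfolding Sum_any.expand_set using that by (intro Ints_sum)
  then show ?thesis
    using assms by (auto simp: integral_coeffs_def lookup_mult when_def intro!: Ints_mult)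
qed

lemma integral_coeffs_of_int: "of_int z \<in> integral_coeffs"
  by (auto simp: integral_coeffs_def lookup_of_int when_def)

lemma integral_coeffs_mvar: "mvar i \<in> integral_coeffs"
  by (auto simp: integral_coeffs_def mvar_def lookup_single when_def)

lemma integral_coeffs_sum: "(\<And>x. x \<in> A \<Longrightarrow> f x \<in> integral_coeffs) \<Longrightarrow> sum f A \<in> integral_coeffs"
  using integral_coeffs_of_int[of 0]
  by (induction A rule: infinite_finite_induct) (auto intro: integral_coeffs_add)

lemma integral_coeffs_prod: "(\<And>x. x \<in> A \<Longrightarrow> f x \<in> integral_coeffs) \<Longrightarrow> prod f A \<in> integral_coeffs"
  using integral_coeffs_of_int[of 1]
  by (induction A rule: infinite_finite_induct) (auto intro: integral_coeffs_mult)

lemma integral_coeffs_power: "p \<in> integral_coeffs \<Longrightarrow> p ^ n \<in> integral_coeffs"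
  using integral_coeffs_of_int[of 1] by (induction n) (auto intro: integral_coeffs_mult)

text \<open>For integer coefficients z m the value is the sum of the squares of the z m times
  products of factorials, a positive integer, hence nonzero in characteristic zero. Over a field
  such as the complex numbers a sum of squares may vanish, whence the integrality.\<close>

lemma apolar_self_nonzero:
  fixes q :: "('k::field_char_0, 'n::finite) mpoly"
  assumes "q \<in> integral_coeffs" "q \<noteq> 0"
  shows "apolar q q \<noteq> 0"
proof -
  have "\<forall>m. \<exists>z. Poly_Mapping.lookup q m = of_int z"
    using assms(1) by (auto simp: integral_coeffs_def elim: Ints_cases)
  then obtain z where z: "\<And>m. Poly_Mapping.lookup q m = of_int (z m)" by metis
  define w where "w m = z m * z m * (\<Prod>i\<in>UNIV. int (fact (Poly_Mapping.lookup m i)))" for m :: "'n \<Rightarrow>\<^sub>0 nat"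
  have "apolar q q = of_int (\<Sum>m\<in>Poly_Mapping.keys q. w m)"
    by (simp add: apolar_def z w_def)
  moreover have "(\<Sum>m\<in>Poly_Mapping.keys q. w m) > 0"
  proof (rule sum_pos)
    show "Poly_Mapping.keys q \<noteq> {}" using assms(2) by (auto simp: poly_mapping_eq_iff fun_eq_iff in_keys_iff)
  next
    fix m assume "m \<in> Poly_Mapping.keys q"
    then have "z m \<noteq> 0" using z[of m] by (auto simp: in_keys_iff)
    then have "z m * z m > 0" by (auto simp: zero_less_mult_iff)
    moreover have "(\<Prod>i\<in>UNIV. int (fact (Poly_Mapping.lookup m i))) > 0"
      by (intro prod_pos) auto
    ultimately show "w m > 0" unfolding w_def by (rule mult_pos_pos)
  qed auto
  ultimately show ?thesis by (metis less_irrefl of_int_eq_0_iff)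
qed


subsection \<open>Multilinear expansion\<close>

lemma module_mscale: "module (mscale :: 'k::comm_ring_1 \<Rightarrow> ('k, 'n) mpoly \<Rightarrow> _)"
  by unfold_locales (auto simp: mscale_def mconst_add mconst_mult algebra_simps)

lemma module_fun_scale: "module (fun_scale :: 'k::field \<Rightarrow> ('x \<Rightarrow> 'k) \<Rightarrow> _)"
  by unfold_locales (auto simp: fun_scale_def fun_eq_iff algebra_simps)

lemma alternating_form_sum:
  fixes \<omega> :: "('i::finite \<Rightarrow> 'v::ab_group_add) \<Rightarrow> 'k::field"
  assumes \<omega>: "alternating_form sc V \<omega>" and sc: "module sc" and V: "module.subspace sc V"
    and w: "range w \<subseteq> V" and x: "\<And>c. c \<in> A \<Longrightarrow> x c \<in> V" and A: "finite A"
  shows "\<omega> (w(i := \<Sum>c\<in>A. sc (a c) (x c))) = (\<Sum>c\<in>A. a c * \<omega> (w(i := x c)))"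
proof -
  interpret module sc by (rule sc)
  have lin: "\<omega> (w(i := sc a x + sc b y)) = a * \<omega> (w(i := x)) + b * \<omega> (w(i := y))"
    if "x \<in> V" "y \<in> V" for a b x y
    using \<omega> w that unfolding alternating_form_def by blast
  show ?thesis
    using A x
  proof (induction A)
    case empty
    show ?case using lin[of 0 0 0 0] subspace_0[OF V] by (simp add: fun_upd_def)
  next
    case (insert c A)
    have "(\<Sum>c\<in>A. sc (a c) (x c)) \<in> V"
      using insert.prems by (intro subspace_sum[OF V] subspace_scale[OF V]) auto
    then show ?case
      using lin[of "x c" "\<Sum>c\<in>A. sc (a c) (x c)" "a c" 1] insert by (simp add: fun_upd_def)
  qed
qed

text \<open>Keeping all functions J, also those with repeated values, avoids collecting terms into
  minors: no signs or orderings of indices enter. The determinant and a general alternating form are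
  expanded by the same formula.\<close>

lemma alternating_form_expand:
  fixes \<omega> :: "('i::finite \<Rightarrow> 'v::ab_group_add) \<Rightarrow> 'k::field" and x :: "'c::finite \<Rightarrow> 'v"
  assumes \<omega>: "alternating_form sc V \<omega>" and sc: "module sc" and V: "module.subspace sc V"
    and x: "\<And>c. x c \<in> V"
  shows "\<omega> (\<lambda>i. \<Sum>c\<in>UNIV. sc (a i c) (x c)) = (\<Sum>J\<in>UNIV. (\<Prod>i\<in>UNIV. a i (J i)) * \<omega> (\<lambda>i. x (J i)))"
proof -
  interpret module sc by (rule sc)
  define X where "X i = (\<Sum>c\<in>UNIV. sc (a i c) (x c))" for i
  have X: "X i \<in> V" for i
    unfolding X_def by (intro subspace_sum[OF V] subspace_scale[OF V] x)
  \<comment> \<open>S collects the slots already expanded. The other slots are pinned by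
    \<open>J\<^sub>0\<close>, so that every stage is a sum over the same type of functions.\<close>
  have "\<omega> (\<lambda>i. if i \<in> S then X i else x (J\<^sub>0 i)) =
      (\<Sum>J\<in>UNIV. if \<forall>i. i \<notin> S \<longrightarrow> J i = J\<^sub>0 i then (\<Prod>i\<in>S. a i (J i)) * \<omega> (\<lambda>i. x (J i)) else 0)"
    if "finite S" for S J\<^sub>0
    using that
  proof (induction S arbitrary: J\<^sub>0)
    case empty
    have "(\<forall>i. J i = J\<^sub>0 i) \<longleftrightarrow> J = J\<^sub>0" for J by auto
    then show ?case by simp
  next
    case (insert s S)
    define w where "w i = (if i \<in> S then X i else x (J\<^sub>0 i))" for i
    have "\<omega> (\<lambda>i. if i \<in> insert s S then X i else x (J\<^sub>0 i)) = \<omega> (w(s := X s))"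
      by (rule arg_cong[of _ _ \<omega>]) (auto simp: w_def)
    also have "\<dots> = (\<Sum>c\<in>UNIV. a s c * \<omega> (w(s := x c)))"
      unfolding X_def by (intro alternating_form_sum[OF \<omega> sc V]) (auto simp: w_def X x)
    also have "\<dots> = (\<Sum>c\<in>UNIV. a s c * \<omega> (\<lambda>i. if i \<in> S then X i else x ((J\<^sub>0(s := c)) i)))"
      using insert.hyps by (intro sum.cong refl arg_cong2[of _ _ _ _ "(*)"] arg_cong[of _ _ \<omega>]) (auto simp: w_def)
    also have "\<dots> = (\<Sum>c\<in>UNIV. \<Sum>J\<in>UNIV. a s c * (if \<forall>i. i \<notin> S \<longrightarrow> J i = (J\<^sub>0(s := c)) i
        then (\<Prod>i\<in>S. a i (J i)) * \<omega> (\<lambda>i. x (J i)) else 0))"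
      unfolding insert.IH sum_distrib_left ..
    also have "\<dots> = (\<Sum>J\<in>UNIV. \<Sum>c\<in>UNIV. a s c * (if \<forall>i. i \<notin> S \<longrightarrow> J i = (J\<^sub>0(s := c)) i
        then (\<Prod>i\<in>S. a i (J i)) * \<omega> (\<lambda>i. x (J i)) else 0))"
      by (rule sum.swap)
    also have "\<dots> = (\<Sum>J\<in>UNIV. \<Sum>c\<in>UNIV. if c = J s then
        (if \<forall>i. i \<notin> insert s S \<longrightarrow> J i = J\<^sub>0 i then (\<Prod>i\<in>insert s S. a i (J i)) * \<omega> (\<lambda>i. x (J i)) else 0) else 0)"
      using insert.hyps by (intro sum.cong refl) (auto simp: mult.assoc)
    finally show ?case by simp
  qed
  from this[of UNIV] show ?thesis by (simp add: X_def)
qed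

lemma prod_sum_UNIV:
  fixes f :: "'i::finite \<Rightarrow> 'c::finite \<Rightarrow> 'r::comm_semiring_1"
  shows "(\<Prod>i\<in>UNIV. \<Sum>c\<in>UNIV. f i c) = (\<Sum>J\<in>UNIV. \<Prod>i\<in>UNIV. f i (J i))"
  by (subst prod_sum_PiE) auto

lemma alternating_form_det:
  "alternating_form (*s) UNIV (\<lambda>r. det (\<chi> i. r i) :: 'k::field)"
  unfolding alternating_form_def
proof (intro conjI allI impI)
  fix w :: "'a \<Rightarrow> 'k ^ 'a" and i a b x y
  have upd: "(\<chi> j. (w(i := z)) j) = (\<chi> j. if j = i then z else w j)" for z
    by (simp add: vec_eq_iff)
  show "det (\<chi> j. (w(i := a *s x + b *s y)) j) = a * det (\<chi> j. (w(i := x)) j) + b * det (\<chi> j. (w(i := y)) j)"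
    unfolding upd by (simp add: det_row_add det_row_mul)
next
  fix w :: "'a \<Rightarrow> 'k ^ 'a" and i j
  assume "i \<noteq> j" "w i = w j"
  then show "det (\<chi> i. w i) = 0"
    by (intro det_identical_rows[of i j]) (auto simp: row_def)
qed

lemma module_vec: "module ((*s) :: 'k::field \<Rightarrow> 'k ^ 'n \<Rightarrow> _)"
  by unfold_locales (auto simp: vec_eq_iff algebra_simps)


subsection \<open>Invariants from the apolar pairing\<close>

text \<open>Indexed by ordered pairs, so each mixed monomial occurs twice: a redundant spanning
  family of the quadrics, for which a linear change expands as a plain double sum without
  symmetrization.\<close>

definition qmon :: "'n \<times> 'n \<Rightarrow> ('k::comm_ring_1, 'n) mpoly"
  where "qmon c = mvar (fst c) * mvar (snd c)"

lemma subspace_forms: "module.subspace mscale (forms d :: ('k::comm_ring_1, 'n::finite) mpoly set)"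
proof -
  interpret module "mscale :: 'k \<Rightarrow> ('k, 'n) mpoly \<Rightarrow> _" by (rule module_mscale)
  show ?thesis
  proof (rule subspaceI)
    show "0 \<in> forms d" by (simp add: forms_def)
    show "p + q \<in> forms d" if "p \<in> forms d" "q \<in> forms d" for p q :: "('k, 'n) mpoly"
      using that keys_add[of p q] unfolding forms_def by blast
    show "mscale c p \<in> forms d" if "p \<in> forms d" for c and p :: "('k, 'n) mpoly"
      using that unfolding forms_def mscale_def by (auto simp: in_keys_iff)
  qed
qed

lemma single_in_forms: "(\<Sum>i\<in>UNIV. Poly_Mapping.lookup m i) = d \<Longrightarrow> Poly_Mapping.single m c \<in> forms d"
  by (auto simp: forms_def split: if_splits)

lemma forms_mult:
  assumes "p \<in> forms d" "q \<in> forms e"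
  shows "p * q \<in> forms (d + e)"
  using assms keys_mult[of p q] unfolding forms_def by (fastforce simp: lookup_add sum.distrib)

lemma mvar_in_forms: "mvar i \<in> forms 1"
  unfolding mvar_def by (rule single_in_forms) (simp add: lookup_single when_def)

lemma qmon_in_forms: "qmon c \<in> forms 2"
  using forms_mult[OF mvar_in_forms mvar_in_forms] unfolding qmon_def by (simp flip: one_add_one)

lemma lin_change_qmon:
  "lin_change h (qmon c) = (\<Sum>d\<in>UNIV. mscale (h $ fst d $ fst c * h $ snd d $ snd c) (qmon d))"
proof -
  have "lin_change h (qmon c) =
      (\<Sum>j\<in>UNIV. \<Sum>l\<in>UNIV. mconst (h $ j $ fst c) * mvar j * (mconst (h $ l $ snd c) * mvar l))"
    unfolding qmon_def lin_change_conv_linsub linsub_mult linsub_mvar sum_product ..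
  also have "\<dots> = (\<Sum>d\<in>UNIV \<times> UNIV. mscale (h $ fst d $ fst c * h $ snd d $ snd c) (qmon d))"
    unfolding sum.cartesian_product by (intro sum.cong) (auto simp: mscale_def mconst_mult qmon_def mult_ac)
  finally show ?thesis by simp
qed

section \<open>The generic matrix and the Omega process\<close>

locale generic_matrix =
  fixes entry :: "'n::finite \<times> 'n \<Rightarrow> 'v::finite" and ty :: "'k::field_char_0 itself"
  assumes bij: "bij entry"
begin

definition gvar :: "'n \<Rightarrow> 'n \<Rightarrow> ('k, 'v) mpoly"
  where "gvar i j = mvar (entry (i, j))"

definition gdet :: "('k, 'v) mpoly"
  where "gdet = det (\<chi> i j. gvar i j)"

text \<open>The value on \<open>\<lambda>i. qmon (w i)\<close> of the translate of \<open>\<eta>\<close> by the generic matrix.\<close>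

definition gact :: "(('i::finite \<Rightarrow> ('k, 'n) mpoly) \<Rightarrow> 'k) \<Rightarrow> ('i \<Rightarrow> 'n \<times> 'n) \<Rightarrow> ('k, 'v) mpoly"
  where "gact \<eta> w = (\<Sum>J\<in>UNIV. mconst (\<eta> (\<lambda>i. qmon (J i))) *
     (\<Prod>i\<in>UNIV. gvar (fst (J i)) (fst (w i)) * gvar (snd (J i)) (snd (w i))))"

text \<open>The substitution of h g for the generic matrix g, as a matrix on the variables: the
  image of the variable at (i, j) contains the one at (k, j) with coefficient
  \<open>h $ i $ k\<close>.\<close>

definition left_mult :: "'k ^ 'n ^ 'n \<Rightarrow> 'v \<Rightarrow> 'v \<Rightarrow> 'k"
  where "left_mult h u v = (if snd (inv entry u) = snd (inv entry v)
     then h $ fst (inv entry v) $ fst (inv entry u) else 0)"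

lemma sum_entry: "(\<Sum>u\<in>UNIV. f u) = (\<Sum>k\<in>UNIV. \<Sum>l\<in>UNIV. f (entry (k, l)))"
proof -
  have "(\<Sum>u\<in>UNIV. f u) = (\<Sum>c\<in>UNIV \<times> UNIV. f (entry c))"
    using sum.reindex_bij_betw[OF bij, of f] by simp
  then show ?thesis by (simp add: sum.cartesian_product)
qed

lemma inv_entry [simp]: "inv entry (entry c) = c"
  using bij by (simp add: bij_is_inj)

lemma linsub_left_mult: "linsub (left_mult h) (gvar i j) = (\<Sum>k\<in>UNIV. mconst (h $ i $ k) * gvar k j)"
proof -
  have "mconst (left_mult h (entry (k, l)) (entry (i, j))) * mvar (entry (k, l)) =
      (if l = j then mconst (h $ i $ k) * gvar k j else 0)" for k l
    by (auto simp: left_mult_def gvar_def)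
  then show ?thesis unfolding gvar_def[of i j] linsub_mvar sum_entry by simp
qed

lemma linsub_left_mult_transpose:
  "linsub (\<lambda>u v. left_mult h v u) (gvar i j) = (\<Sum>k\<in>UNIV. mconst (h $ k $ i) * gvar k j)"
proof -
  have "mconst (left_mult h (entry (i, j)) (entry (k, l))) * mvar (entry (k, l)) =
      (if l = j then mconst (h $ k $ i) * gvar k j else 0)" for k l
    by (auto simp: left_mult_def gvar_def)
  then show ?thesis unfolding gvar_def[of i j] linsub_mvar sum_entry by simp
qed

lemma det_mconst: "det (\<chi> i j. mconst (h $ i $ j)) = mconst (det h)"
  by (simp add: mconst.C_det)

lemma linsub_gdet: "linsub (left_mult h) gdet = mconst (det h) * gdet"
proof -
  have "linsub (left_mult h) gdet = det ((\<chi> i j. mconst (h $ i $ j)) ** (\<chi> i j. gvar i j))"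
    unfolding gdet_def linsub_def lin.C_det
    by (simp add: linsub_left_mult[unfolded linsub_def] matrix_matrix_mult_def)
  then show ?thesis unfolding det_mul det_mconst gdet_def .
qed

lemma linsub_transpose_gdet: "linsub (\<lambda>u v. left_mult h v u) gdet = mconst (det h) * gdet"
proof -
  have "linsub (\<lambda>u v. left_mult h v u) gdet = det ((\<chi> i j. mconst (transpose h $ i $ j)) ** (\<chi> i j. gvar i j))"
    unfolding gdet_def linsub_def lin.C_det
    by (simp add: linsub_left_mult_transpose[unfolded linsub_def] matrix_matrix_mult_def transpose_def)
  then show ?thesis unfolding det_mul det_mconst gdet_def by simp
qed

text \<open>Evaluating \<eta> on a family moved by g and then by h is evaluating the h-translate of
  \<eta> on the family moved by g. For formal g this becomes an exchange of two multilinear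
  expansions.\<close>

lemma linsub_gact:
  assumes \<eta>: "alternating_form mscale (forms 2) \<eta>"
  shows "linsub (left_mult h) (gact \<eta> w) = gact (\<lambda>w. \<eta> (\<lambda>i. lin_change h (w i))) w"
proof -
  let ?h = "\<lambda>c d. h $ fst d $ fst c * h $ snd d $ snd c"
  let ?g = "\<lambda>c d. gvar (fst c) (fst d) * gvar (snd c) (snd d)"
  have expand: "\<eta> (\<lambda>i. lin_change h (qmon (J i))) = (\<Sum>J'\<in>UNIV. (\<Prod>i\<in>UNIV. ?h (J i) (J' i)) * \<eta> (\<lambda>i. qmon (J' i)))" for J
    unfolding lin_change_qmon
    by (rule alternating_form_expand[OF \<eta> module_mscale subspace_forms qmon_in_forms])
  have sub: "linsub (left_mult h) (?g c d) = (\<Sum>c'\<in>UNIV. mconst (?h c' c) * ?g c' d)" for c d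
  proof -
    have "linsub (left_mult h) (?g c d) = (\<Sum>k\<in>UNIV. \<Sum>l\<in>UNIV.
        mconst (h $ fst c $ k) * gvar k (fst d) * (mconst (h $ snd c $ l) * gvar l (snd d)))"
      unfolding linsub_mult linsub_left_mult sum_product ..
    also have "\<dots> = (\<Sum>c'\<in>UNIV \<times> UNIV. mconst (?h c' c) * ?g c' d)"
      unfolding sum.cartesian_product by (intro sum.cong) (auto simp: mconst_mult mult_ac)
    finally show ?thesis by simp
  qed
  have "linsub (left_mult h) (gact \<eta> w) =
      (\<Sum>J'\<in>UNIV. mconst (\<eta> (\<lambda>i. qmon (J' i))) * (\<Prod>i\<in>UNIV. \<Sum>c\<in>UNIV. mconst (?h c (J' i)) * ?g c (w i)))"
    unfolding gact_def linsub_def lin.C_sum lin.C_mult lin.C_prod mconst.mpoly_subst_mconst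
    unfolding linsub_def[symmetric] linsub_mult[symmetric] sub ..
  also have "\<dots> = (\<Sum>J'\<in>UNIV. \<Sum>J\<in>UNIV. mconst ((\<Prod>i\<in>UNIV. ?h (J i) (J' i)) * \<eta> (\<lambda>i. qmon (J' i))) * (\<Prod>i\<in>UNIV. ?g (J i) (w i)))"
    by (simp only: prod_sum_UNIV sum_distrib_left prod.distrib mconst_mult mconst_prod mult_ac)
  also have "\<dots> = (\<Sum>J\<in>UNIV. \<Sum>J'\<in>UNIV. mconst ((\<Prod>i\<in>UNIV. ?h (J i) (J' i)) * \<eta> (\<lambda>i. qmon (J' i))) * (\<Prod>i\<in>UNIV. ?g (J i) (w i)))"
    by (rule sum.swap)
  also have "\<dots> = gact (\<lambda>w. \<eta> (\<lambda>i. lin_change h (w i))) w"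
    unfolding gact_def expand mconst_sum sum_distrib_right ..
  finally show ?thesis .
qed

text \<open>Cayley's Omega process, in the guise of pairing with a power of the generic determinant.\<close>

definition omega_invariant ::
  "nat \<Rightarrow> nat \<Rightarrow> ('i::finite \<Rightarrow> 'n \<times> 'n) list \<Rightarrow> (('i \<Rightarrow> ('k, 'n) mpoly) \<Rightarrow> 'k) \<Rightarrow> 'k"
  where "omega_invariant j M ws \<eta> = apolar (gdet ^ j * (\<Prod>l<length ws. gact \<eta> (ws ! l))) (gdet ^ M)"

text \<open>Translating \<eta> by h substitutes h g for g in the left argument, where
  \<open>gdet\<close> is unchanged as det h = 1. By adjointness this equals substituting with the
  transpose of h in \<open>gdet ^ M\<close>, which is fixed for the same reason.\<close>

lemma SL_invariant_omega_invariant: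
  fixes ws :: "('i::finite \<Rightarrow> 'n \<times> 'n) list"
  shows "SL_invariant (omega_invariant j M ws)"
  unfolding SL_invariant_def
proof (intro allI impI)
  fix h :: "'k ^ 'n ^ 'n" and \<eta> :: "('i \<Rightarrow> ('k, 'n) mpoly) \<Rightarrow> 'k"
  assume h: "det h = 1" and \<eta>: "alternating_form mscale (forms 2) \<eta>"
  have pow: "linsub H (p ^ n) = linsub H p ^ n" for H n and p :: "('k, 'v) mpoly"
    unfolding linsub_def by (rule lin.C_power)
  have prod: "linsub H (prod f A) = (\<Prod>x\<in>A. linsub H (f x))" for H A and f :: "nat \<Rightarrow> ('k, 'v) mpoly"
    unfolding linsub_def by (rule lin.C_prod)
  have "linsub (left_mult h) (gdet ^ j * (\<Prod>l<length ws. gact \<eta> (ws ! l))) =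
      gdet ^ j * (\<Prod>l<length ws. gact (\<lambda>w. \<eta> (\<lambda>i. lin_change h (w i))) (ws ! l))"
    unfolding linsub_mult pow prod linsub_gdet linsub_gact[OF \<eta>] h by simp
  moreover have "linsub (\<lambda>u v. left_mult h v u) (gdet ^ M) = gdet ^ M"
    unfolding pow linsub_transpose_gdet h by simp
  ultimately show "omega_invariant j M ws (\<lambda>w. \<eta> (\<lambda>i. lin_change h (w i))) = omega_invariant j M ws \<eta>"
    unfolding omega_invariant_def using apolar_linsub[of "left_mult h"] by metis
qed

text \<open>The pairing is linear: expanding the product of the \<open>gact\<close> terms shows the
  invariant as a combination, with pairings as constants, of products of \<open>length ws\<close>
  coordinates of \<eta>.\<close>

lemma omega_invariant_in_O_sections:
  fixes ws :: "('i::finite \<Rightarrow> 'n \<times> 'n) list"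
  shows "omega_invariant j M ws \<in> O_sections (length ws)"
proof -
  interpret F: module "fun_scale :: 'k \<Rightarrow> ((('i \<Rightarrow> ('k, 'n) mpoly) \<Rightarrow> 'k) \<Rightarrow> 'k) \<Rightarrow> _"
    by (rule module_fun_scale)
  let ?n = "length ws"
  let ?P = "\<Pi>\<^sub>E l\<in>{..<?n}. (UNIV :: ('i \<Rightarrow> 'n \<times> 'n) set)"
  define mono where "mono Js = (\<Prod>l<?n. \<Prod>i\<in>UNIV. gvar (fst (Js l i)) (fst ((ws ! l) i)) * gvar (snd (Js l i)) (snd ((ws ! l) i)))"
    for Js :: "nat \<Rightarrow> 'i \<Rightarrow> 'n \<times> 'n"
  have sum_apply: "(\<Sum>x\<in>A. f x) y = (\<Sum>x\<in>A. f x y)" for A and f :: "(nat \<Rightarrow> 'i \<Rightarrow> 'n \<times> 'n) \<Rightarrow> 'z \<Rightarrow> 'k" and y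
    by (induction A rule: infinite_finite_induct) auto
  have "omega_invariant j M ws = (\<Sum>Js\<in>?P. fun_scale (apolar (gdet ^ j * mono Js) (gdet ^ M))
      (\<lambda>\<eta>. \<Prod>l<?n. \<eta> (\<lambda>i. qmon (Js l i))))"
  proof
    fix \<eta> :: "('i \<Rightarrow> ('k, 'n) mpoly) \<Rightarrow> 'k"
    have "(\<Prod>l<?n. gact \<eta> (ws ! l)) = (\<Sum>Js\<in>?P. mconst (\<Prod>l<?n. \<eta> (\<lambda>i. qmon (Js l i))) * mono Js)"
      unfolding gact_def
      by (subst prod_sum_PiE; simp only: finite_lessThan finite mono_def prod.distrib mconst_prod)
    then have "omega_invariant j M ws \<eta> = (\<Sum>Js\<in>?P. apolar (mconst (\<Prod>l<?n. \<eta> (\<lambda>i. qmon (Js l i))) * (gdet ^ j * mono Js)) (gdet ^ M))"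
      unfolding omega_invariant_def by (simp add: sum_distrib_left apolar_sum_left mult.left_commute)
    then show "omega_invariant j M ws \<eta> = (\<Sum>Js\<in>?P. fun_scale (apolar (gdet ^ j * mono Js) (gdet ^ M))
      (\<lambda>\<eta>. \<Prod>l<?n. \<eta> (\<lambda>i. qmon (Js l i)))) \<eta>"
      unfolding sum_apply fun_scale_def apolar_mconst_left by (simp add: mult.commute)
  qed
  also have "\<dots> \<in> O_sections ?n"
    unfolding O_sections_def
    by (intro F.span_sum F.span_scale F.span_base CollectI exI conjI refl) (auto intro: qmon_in_forms)
  finally show ?thesis .
qed

lemma gdet_integral: "gdet \<in> integral_coeffs"
  unfolding gdet_def det_def gvar_def
  by (intro integral_coeffs_sum integral_coeffs_mult integral_coeffs_of_int integral_coeffs_prod) (simp add: integral_coeffs_mvar)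

lemma gdet_power_nonzero: "gdet ^ n \<noteq> 0"
proof -
  \<comment> \<open>The point at which the generic matrix is the identity.\<close>
  let ?x = "\<lambda>u. (if fst (inv entry u) = snd (inv entry u) then 1 else 0 :: 'k)"
  have "mpoly_subst (\<lambda>x. x) ?x gdet = det (mat 1 :: 'k ^ 'n ^ 'n)"
    unfolding gdet_def meval.C_det gvar_def
    by (simp add: coeff_hom.mpoly_subst_mvar[OF coeff_hom_id] mat_def)
  then have "mpoly_subst (\<lambda>x. x) ?x (gdet ^ n) = 1" unfolding meval.C_power by simp
  then show ?thesis using meval.C_0[of ?x] by auto
qed

end

text \<open>Sums and differences suffice: they yield a non-unital subring of fractions, and an
  additive functional that is nonzero on a member is nonzero on some generator.\<close>

inductive_set add_closure :: "'a::ab_group_add set \<Rightarrow> 'a set" for B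
  where
    zero: "0 \<in> add_closure B"
  | base: "b \<in> B \<Longrightarrow> b \<in> add_closure B"
  | diff: "x \<in> add_closure B \<Longrightarrow> y \<in> add_closure B \<Longrightarrow> x - y \<in> add_closure B"

lemma add_closure_mult:
  fixes B B' :: "'a::comm_ring set"
  assumes "\<And>b b'. b \<in> B \<Longrightarrow> b' \<in> B' \<Longrightarrow> b * b' \<in> B''" "x \<in> add_closure B" "y \<in> add_closure B'"
  shows "x * y \<in> add_closure B''"
  using assms(2)
proof induction
  case (base b)
  show ?case using assms(3)
    by induction (auto intro: add_closure.intros assms(1) base simp: right_diff_distrib)
qed (auto intro: add_closure.intros simp: left_diff_distrib)

lemma coeff_hom_to_fract: "coeff_hom to_fract"
  by unfold_locales auto

interpretation to_fract: coeff_hom to_fract by (rule coeff_hom_to_fract)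


lemma prod_list_map_conv_nth: "prod_list (map f xs) = (\<Prod>l<length xs. f (xs ! l) :: 'a::comm_monoid_mult)"
  by (induction xs) (auto simp: prod.lessThan_Suc_shift simp del: prod.lessThan_Suc)

text \<open>A linear order on the variables orders the exponent vectors, so that the polynomial ring
  is an integral domain and \<open>to_fract\<close> embeds it in the function field of the generic
  matrix.\<close>

locale ordered_generic_matrix = generic_matrix entry ty
  for entry :: "'n::finite \<times> 'n \<Rightarrow> 'v::{finite, linorder}" and ty :: "'k::field_char_0 itself"
begin

text \<open>Membership in \<open>I\<close> means positive valuation: in the second case all translates of \<open>\<omega>\<close> are small
  relative to the determinant.\<close>

lemma semistable_or_valuation:
  fixes \<omega> :: "('i::finite \<Rightarrow> ('k, 'n) mpoly) \<Rightarrow> 'k"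
  assumes r: "r > 0"
  shows "GIT_semistable \<omega> \<or> (\<exists>I. maximal_nonunital_subring I \<and>
    (\<forall>ws. length ws = r \<longrightarrow> to_fract (prod_list (map (gact \<omega>) ws)) / to_fract (gdet ^ s) \<in> I))"
proof (rule disjCI)
  assume unstable: "\<not> (\<exists>I. maximal_nonunital_subring I \<and>
    (\<forall>ws. length ws = r \<longrightarrow> to_fract (prod_list (map (gact \<omega>) ws)) / to_fract (gdet ^ s) \<in> I))"
  \<comment> \<open>Numerators, over the common denominator \<open>gdet ^ (s * N)\<close>, of
    products of m of the quotients; 1 \<le> m excludes the constant term, and m \<le> N keeps N - m
    exact.\<close>
  define B where "B N = {gdet ^ (s * (N - m)) * prod_list (map (gact \<omega>) ws) | m ws.
    length ws = r * m \<and> 1 \<le> m \<and> m \<le> N}" for N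
  have B_shift: "gdet ^ (s * M) * b \<in> B (N + M)" if "b \<in> B N" for N M b
  proof -
    obtain m ws where b: "b = gdet ^ (s * (N - m)) * prod_list (map (gact \<omega>) ws)"
      "length ws = r * m" "1 \<le> m" "m \<le> N" using \<open>b \<in> B N\<close> unfolding B_def by blast
    have "M + (N - m) = N + M - m" using b by simp
    then have "s * M + s * (N - m) = s * (N + M - m)" by (simp only: add_mult_distrib2[symmetric])
    then have "gdet ^ (s * M) * b = gdet ^ (s * (N + M - m)) * prod_list (map (gact \<omega>) ws)"
      unfolding b(1) mult.assoc[symmetric] power_add[symmetric] by simp
    then show ?thesis unfolding B_def using b by (auto intro!: exI[of _ m] exI[of _ ws])
  qed
  have B_mult: "b * c \<in> B (N + M)" if "b \<in> B N" "c \<in> B M" for N M b c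
  proof -
    obtain m ws where b: "b = gdet ^ (s * (N - m)) * prod_list (map (gact \<omega>) ws)"
      "length ws = r * m" "1 \<le> m" "m \<le> N" using \<open>b \<in> B N\<close> unfolding B_def by blast
    obtain l us where c: "c = gdet ^ (s * (M - l)) * prod_list (map (gact \<omega>) us)"
      "length us = r * l" "1 \<le> l" "l \<le> M" using \<open>c \<in> B M\<close> unfolding B_def by blast
    have "(N - m) + (M - l) = N + M - (m + l)" using b c by simp
    then have "s * (N - m) + s * (M - l) = s * (N + M - (m + l))" by (simp only: add_mult_distrib2[symmetric])
    then have pow: "gdet ^ (s * (N + M - (m + l))) = gdet ^ (s * (N - m)) * gdet ^ (s * (M - l))"
      by (simp only: power_add[symmetric])
    have "b * c = gdet ^ (s * (N + M - (m + l))) * prod_list (map (gact \<omega>) (ws @ us))"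
      unfolding b(1) c(1) pow by (simp add: mult_ac)
    moreover have "length (ws @ us) = r * (m + l)" using b c by (simp add: distrib_left)
    ultimately show ?thesis unfolding B_def using b c
      by (intro CollectI exI[of _ "m + l"] exI[of _ "ws @ us"]) auto
  qed
  \<comment> \<open>The polynomials without constant term, with integer coefficients, in the given
    quotients.\<close>
  define I\<^sub>0 where "I\<^sub>0 = {to_fract p / to_fract (gdet ^ (s * N)) | p N. p \<in> add_closure (B N)}"
  have nz: "to_fract (gdet ^ n) \<noteq> 0" for n
    using gdet_power_nonzero by simp
  have sub: "nonunital_subring I\<^sub>0"
  proof (rule nonunital_subringI)
    show "0 \<in> I\<^sub>0" unfolding I\<^sub>0_def using add_closure.zero by force
  next
    fix x y assume "x \<in> I\<^sub>0" "y \<in> I\<^sub>0"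
    then obtain p N q M where x: "x = to_fract p / to_fract (gdet ^ (s * N))" "p \<in> add_closure (B N)"
      and y: "y = to_fract q / to_fract (gdet ^ (s * M))" "q \<in> add_closure (B M)"
      unfolding I\<^sub>0_def by blast
    have dd: "to_fract (gdet ^ (s * (N + M))) = to_fract (gdet ^ (s * N)) * to_fract (gdet ^ (s * M))"
      by (simp add: distrib_left power_add)
    have shift: "gdet ^ (s * M) * p \<in> add_closure (B (N + M))" if "p \<in> add_closure (B N)" for p N M
      by (rule add_closure_mult[of "{gdet ^ (s * M)}" "B N"]) (auto intro: B_shift that add_closure.base)
    have "x - y = to_fract (gdet ^ (s * M) * p - gdet ^ (s * N) * q) / to_fract (gdet ^ (s * (N + M)))"
      unfolding x y dd using nz by (simp add: to_fract.C_diff field_simps)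
    moreover have "gdet ^ (s * M) * p - gdet ^ (s * N) * q \<in> add_closure (B (N + M))"
      using shift[OF x(2), of M] shift[OF y(2), of N] by (auto intro: add_closure.diff simp: add.commute)
    ultimately show "x - y \<in> I\<^sub>0" unfolding I\<^sub>0_def by blast
    have "x * y = to_fract (p * q) / to_fract (gdet ^ (s * (N + M)))"
      unfolding x y dd by simp
    moreover have "p * q \<in> add_closure (B (N + M))"
      by (rule add_closure_mult[OF B_mult x(2) y(2)])
    ultimately show "x * y \<in> I\<^sub>0" unfolding I\<^sub>0_def by blast
  qed
  have gen: "to_fract (prod_list (map (gact \<omega>) ws)) / to_fract (gdet ^ s) \<in> I\<^sub>0" if "length ws = r" for ws
  proof -
    have "prod_list (map (gact \<omega>) ws) \<in> B 1" unfolding B_def using that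
      by (auto intro!: exI[of _ 1] exI[of _ ws])
    from add_closure.base[OF this] show ?thesis unfolding I\<^sub>0_def
      by (intro CollectI exI[of _ "prod_list (map (gact \<omega>) ws)"] exI[of _ 1]) simp
  qed
  have "1 \<in> I\<^sub>0"
  proof (rule ccontr)
    assume "1 \<notin> I\<^sub>0"
    from maximal_nonunital_subring_exists[OF sub this] unstable gen show False by blast
  qed
  then obtain p N where p: "1 = to_fract p / to_fract (gdet ^ (s * N))" "p \<in> add_closure (B N)"
    unfolding I\<^sub>0_def by blast
  have "to_fract p = to_fract (gdet ^ (s * N))"
    using p(1) nz[of "s * N"] by (simp add: field_simps)
  then have p_eq: "p = gdet ^ (s * N)" by simp
  \<comment> \<open>The numerator is \<open>gdet ^ (s * N)\<close>, which pairs nontrivially with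
    itself. By additivity some generator pairs nontrivially with it, and that generator is a product
    of r m coordinates times a power of \<open>gdet\<close>.\<close>
  have "\<exists>b\<in>B N. apolar b (gdet ^ (s * N)) \<noteq> 0"
  proof (rule ccontr)
    assume "\<not> ?thesis"
    with p(2) have "apolar p (gdet ^ (s * N)) = 0"
      by induction (auto simp: apolar_diff_left)
    then show False unfolding p_eq
      using apolar_self_nonzero[OF integral_coeffs_power[OF gdet_integral] gdet_power_nonzero] by blast
  qed
  then obtain m ws where ws: "apolar (gdet ^ (s * (N - m)) * prod_list (map (gact \<omega>) ws)) (gdet ^ (s * N)) \<noteq> 0"
      "length ws = r * m" "1 \<le> m" unfolding B_def by blast
  have "prod_list (map (gact \<omega>) ws) = (\<Prod>l<length ws. gact \<omega> (ws ! l))"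
    by (rule prod_list_map_conv_nth)
  then have "omega_invariant (s * (N - m)) (s * N) ws \<omega> \<noteq> 0"
    using ws(1) unfolding omega_invariant_def by simp
  then show "GIT_semistable \<omega>"
    unfolding GIT_semistable_def using ws(2,3) r
    by (intro exI[of _ "length ws"] conjI bexI[OF _ omega_invariant_in_O_sections]
        SL_invariant_omega_invariant) auto
qed

end


subsection \<open>The torus weights of the curve\<close>

lemma UNIV_5: "(UNIV :: 5 set) = {0, 1, 2, 3, 4}"
  by (rule sym, rule card_subset_eq) auto

text \<open>The exponents of t in \<open>nu 1 t\<close>, the weights of the torus that preserves the
  curve. They increase with the index, so an upper triangular matrix adds to a coordinate only terms
  of higher weight.\<close>

definition texp :: "5 \<Rightarrow> nat"
  where "texp i = (if i = 0 then 0 else if i = 1 then 2 else if i = 2 then 3 else if i = 3 then 4 else 6)"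

lemma texp_simps [simp]: "texp 0 = 0" "texp 1 = 2" "texp 2 = 3" "texp 3 = 4" "texp 4 = 6"
  by (simp_all add: texp_def)

lemma strict_mono_texp: "strict_mono texp"
proof (rule strict_monoI)
  fix a b :: 5 assume "a < b"
  moreover have "a \<in> {0, 1, 2, 3, 4}" "b \<in> {0, 1, 2, 3, 4}" using UNIV_5 by blast+
  ultimately show "texp a < texp b"
    by (auto simp: less_bit1_def bit1.Rep_0 bit1.Rep_1 bit1.Rep_numeral)
qed

text \<open>The exponents of t that quadrics attain on the curve: from 0 to 12, the cusps at t = 0
  and at infinity remove 1 and 11.\<close>

definition wts :: "nat set"
  where "wts = {0, 2, 3, 4, 5, 6, 7, 8, 9, 10, 12}"

text \<open>The residues modulo 11 enumerate \<open>wts\<close> in increasing order; this order of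
  the columns is what makes the determinants below triangular.\<close>

definition wt :: "11 \<Rightarrow> nat"
  where "wt i = [0, 2, 3, 4, 5, 6, 7, 8, 9, 10, 12] ! nat (Rep_bit1 i)"

lemma strict_mono_wt: "strict_mono wt"
proof (rule strict_monoI)
  fix a b :: 11 assume "a < b"
  then have *: "nat (Rep_bit1 a) < nat (Rep_bit1 b)" "nat (Rep_bit1 b) < 11"
    using Rep_bit1[of a] Rep_bit1[of b] by (auto simp: less_bit1_def)
  have "sorted_wrt (<) [0::nat, 2, 3, 4, 5, 6, 7, 8, 9, 10, 12]" by simp
  from sorted_wrt_nth_less[OF this *(1)] *(2) show "wt a < wt b"
    unfolding wt_def by simp
qed

lemma bij_betw_wt: "bij_betw wt UNIV wts"
proof -
  have inj: "inj wt" using strict_mono_wt by (rule strict_mono_imp_inj_on)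
  have "wt i \<in> wts" for i
  proof -
    have "nat (Rep_bit1 i) < 11" using Rep_bit1[of i] by auto
    then have "wt i \<in> set [0, 2, 3, 4, 5, 6, 7, 8, 9, 10, 12]"
      unfolding wt_def by (intro nth_mem) simp
    then show ?thesis by (simp add: wts_def)
  qed
  then have "range wt \<subseteq> wts" by blast
  moreover have "card wts = 11" by (simp add: wts_def)
  moreover have "card (range wt) = 11" using inj by (simp add: card_image)
  ultimately have "range wt = wts" by (intro card_subset_eq) (auto simp: wts_def)
  with inj show ?thesis by (simp add: bij_betw_def)
qed

text \<open>The linear form with the coefficients of row a of M, restricted to the curve in the
  chart s = 1.\<close>

definition row_poly :: "'a::field ^ 5 ^ 5 \<Rightarrow> 5 \<Rightarrow> 'a poly"
  where "row_poly M a = (\<Sum>b\<in>UNIV. monom (M $ a $ b) (texp b))"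

text \<open>Eleven such rows form the matrix whose determinant is a coordinate of the translated
  Hilbert point, when M is the transpose of the acting matrix.\<close>

definition quad_row :: "'a::field ^ 5 ^ 5 \<Rightarrow> 5 \<times> 5 \<Rightarrow> 'a ^ 11"
  where "quad_row M c = (\<chi> j. coeff (row_poly M (fst c) * row_poly M (snd c)) (wt j))"

lemma smult_sum_right: "smult a (sum f A) = (\<Sum>x\<in>A. smult a (f x))"
  by (induction A rule: infinite_finite_induct) (auto simp: smult_add_right)

lemma row_poly_mult: "row_poly (A ** M) a = (\<Sum>b\<in>UNIV. smult (A $ a $ b) (row_poly M b))"
proof -
  have "row_poly (A ** M) a = (\<Sum>c\<in>UNIV. \<Sum>b\<in>UNIV. smult (A $ a $ b) (monom (M $ b $ c) (texp c)))"
    unfolding row_poly_def by (simp add: matrix_matrix_mult_def smult_monom monom_sum)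
  also have "\<dots> = (\<Sum>b\<in>UNIV. smult (A $ a $ b) (row_poly M b))"
    unfolding row_poly_def smult_sum_right by (rule sum.swap)
  finally show ?thesis .
qed

lemma quad_row_mult:
  "quad_row (A ** M) c = (\<Sum>d\<in>UNIV. (A $ fst c $ fst d * A $ snd c $ snd d) *s quad_row M d)"
proof -
  have "row_poly (A ** M) (fst c) * row_poly (A ** M) (snd c) =
      (\<Sum>d\<in>UNIV \<times> UNIV. smult (A $ fst c $ fst d * A $ snd c $ snd d) (row_poly M (fst d) * row_poly M (snd d)))"
    unfolding row_poly_mult sum_product sum.cartesian_product
    by (intro sum.cong) (auto simp: mult_ac)
  then show ?thesis
    unfolding quad_row_def by (simp add: vec_eq_iff coeff_sum)
qed

text \<open>Serves twice: with M the identity it identifies the translated coordinates with such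
  determinants, and with A over the valuation ring it writes the coordinates after triangularization
  as integral combinations of those before.\<close>

lemma det_quad_row_mult:
  fixes w :: "11 \<Rightarrow> 5 \<times> 5"
  shows "det (\<chi> i. quad_row (A ** M) (w i)) =
    (\<Sum>J\<in>UNIV. (\<Prod>i\<in>UNIV. A $ fst (w i) $ fst (J i) * A $ snd (w i) $ snd (J i)) * det (\<chi> i. quad_row M (J i)))"
proof -
  show ?thesis unfolding quad_row_mult
    by (rule alternating_form_expand[where V = UNIV and sc = "(*s)" and \<omega> = "\<lambda>r. det (\<chi> i. r i)"])
      (auto simp: alternating_form_det module_vec)
qed

lemma coeff_mult_lowest:
  assumes "\<And>k. k < m \<Longrightarrow> coeff p k = 0" "\<And>k. k < n \<Longrightarrow> coeff q k = 0"
  shows "coeff (p * q) (m + n) = coeff p m * coeff q n" "k < m + n \<Longrightarrow> coeff (p * q) k = 0"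
proof -
  have "coeff p i * coeff q (m + n - i) = 0" if "i \<noteq> m" "i \<le> m + n" for i
    using that assms(1)[of i] assms(2)[of "m + n - i"] by (cases "i < m") auto
  then have "coeff (p * q) (m + n) = (\<Sum>i\<le>m + n. if i = m then coeff p m * coeff q n else 0)"
    unfolding coeff_mult by (intro sum.cong) auto
  then show "coeff (p * q) (m + n) = coeff p m * coeff q n" by simp
  have "coeff p i * coeff q (k - i) = 0" if "k < m + n" "i \<le> k" for i
    using that assms(1)[of i] assms(2)[of "k - i"] by (cases "i < m") auto
  then show "coeff (p * q) k = 0" if "k < m + n" using that unfolding coeff_mult by simp
qed

lemma coeff_row_poly: "coeff (row_poly M a) k = (\<Sum>b\<in>UNIV. if texp b = k then M $ a $ b else 0)"
  by (simp add: row_poly_def coeff_sum coeff_monom when_def)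

text \<open>Row a of Z starts at exponent \<open>texp a\<close> with coefficient
  \<open>Z $ a $ a\<close>, so the i-th quadric starts at weight \<open>wt i\<close>. With rows and
  columns in order of weight the matrix is upper triangular, and only the diagonal of Z is
  seen.\<close>

lemma det_quad_row_triangular:
  fixes w :: "11 \<Rightarrow> 5 \<times> 5"
  assumes Z: "\<And>i j. j < i \<Longrightarrow> Z $ i $ j = 0" and w: "\<And>i. texp (fst (w i)) + texp (snd (w i)) = wt i"
  shows "det (\<chi> i. quad_row Z (w i)) = (\<Prod>i\<in>UNIV. Z $ fst (w i) $ fst (w i) * Z $ snd (w i) $ snd (w i))"
proof -
  have low: "coeff (row_poly Z a) k = 0" if "k < texp a" for a k
  proof -
    have "Z $ a $ b = 0" if "texp b = k" for b
      using \<open>k < texp a\<close> that Z strict_mono_less[OF strict_mono_texp] by blast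
    then show ?thesis unfolding coeff_row_poly by (intro sum.neutral) auto
  qed
  have lead: "coeff (row_poly Z a) (texp a) = Z $ a $ a" for a
    unfolding coeff_row_poly using strict_mono_eq[OF strict_mono_texp] by simp
  have "det (\<chi> i. quad_row Z (w i)) = (\<Prod>i\<in>UNIV. (\<chi> i. quad_row Z (w i)) $ i $ i)"
  proof (rule det_upperdiagonal)
    fix i j :: 11 assume "j < i"
    then have "wt j < texp (fst (w i)) + texp (snd (w i))" unfolding w using strict_mono_wt by (simp add: strict_monoD)
    from coeff_mult_lowest(2)[OF low low this] show "(\<chi> i. quad_row Z (w i)) $ i $ j = 0"
      by (simp add: quad_row_def)
  qed
  then show ?thesis
    by (simp add: quad_row_def w[symmetric] coeff_mult_lowest(1)[OF low low] lead)
qed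

lemma quad_row_mat_1: "quad_row (mat 1 :: 'a::field ^ 5 ^ 5) c = (\<chi> j. if texp (fst c) + texp (snd c) = wt j then 1 else 0)"
proof -
  have "row_poly (mat 1 :: 'a ^ 5 ^ 5) a = monom 1 (texp a)" for a
  proof -
    have "row_poly (mat 1 :: 'a ^ 5 ^ 5) a = (\<Sum>b\<in>UNIV. if b = a then monom 1 (texp a) else 0)"
      unfolding row_poly_def by (intro sum.cong) (auto simp: mat_def)
    then show ?thesis by simp
  qed
  then show ?thesis by (simp add: quad_row_def mult_monom vec_eq_iff)
qed

text \<open>These monomials restrict to a basis of the quadratic sections. Taken twice with \<open>m = (0, 4)\<close>,
  twice with \<open>m = (1, 3)\<close> and once with \<open>m = (2, 2)\<close>, each variable occurs 22 times.\<close>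

definition basis_mon :: "5 \<times> 5 \<Rightarrow> nat \<Rightarrow> 5 \<times> 5"
  where "basis_mon m k = (if k = 0 then (0, 0) else if k = 2 then (0, 1) else if k = 3 then (0, 2)
    else if k = 4 then (1, 1) else if k = 5 then (1, 2) else if k = 6 then m else if k = 7 then (2, 3)
    else if k = 8 then (3, 3) else if k = 9 then (2, 4) else if k = 10 then (3, 4) else (4, 4))"

lemma basis_mon_weight:
  assumes "texp (fst m) + texp (snd m) = 6"
  shows "texp (fst (basis_mon m (wt i))) + texp (snd (basis_mon m (wt i))) = wt i"
proof -
  have "wt i \<in> wts" using bij_betw_wt by (auto simp: bij_betw_def)
  then show ?thesis using assms unfolding wts_def by (auto simp: basis_mon_def)
qed

text \<open>The ten monomials of weight other than 6 contain each of the five variables exactly four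
  times, so only m affects the balance.\<close>

lemma prod_basis_mon:
  fixes z :: "5 \<Rightarrow> 'a::comm_ring_1"
  shows "(\<Prod>i\<in>UNIV. z (fst (basis_mon m (wt i))) * z (snd (basis_mon m (wt i)))) =
    (\<Prod>a\<in>UNIV. z a) ^ 4 * (z (fst m) * z (snd m))"
proof -
  have "(\<Prod>i\<in>UNIV. z (fst (basis_mon m (wt i))) * z (snd (basis_mon m (wt i)))) =
      (\<Prod>k\<in>wts. z (fst (basis_mon m k)) * z (snd (basis_mon m k)))"
    by (rule prod.reindex_bij_betw[OF bij_betw_wt])
  also have "\<dots> = (\<Prod>a\<in>UNIV. z a) ^ 4 * (z (fst m) * z (snd m))"
    unfolding wts_def UNIV_5 by (simp add: basis_mon_def power4_eq_xxxx mult_ac)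
  finally show ?thesis .
qed

text \<open>The hypothesis prescribes \<omega> on tuples of monomials, which is all that
  \<open>gact\<close> reads. The determinant there is the coordinate of the curve: a monomial of
  weight \<open>wt j\<close> restricts to the j-th basis section.\<close>

lemma cuspidal_GIT_semistable:
  fixes \<omega> :: "(11 \<Rightarrow> ('k::field_char_0, 5) mpoly) \<Rightarrow> 'k"
  assumes \<omega>: "\<And>J. \<omega> (\<lambda>i. qmon (J i)) =
    det (\<chi> i j. if texp (fst (J i)) + texp (snd (J i)) = wt j then 1 else 0)"
  shows "GIT_semistable \<omega>"
proof -
  obtain entry :: "5 \<times> 5 \<Rightarrow> 25" where "bij entry"
    using finite_same_card_bij[of "UNIV :: (5 \<times> 5) set" "UNIV :: 25 set"] by auto
  then interpret ordered_generic_matrix entry "TYPE('k)" by unfold_locales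
  \<comment> \<open>Transposed, because \<open>lin_change\<close> sends x_a to the form whose
    coefficients are column a of the matrix.\<close>
  define Y where "Y = (\<chi> a j. to_fract (gvar j a))"
  define D where "D w = det (\<chi> i. quad_row Y (w i))" for w
  have gact: "to_fract (gact \<omega> w) = D w" for w
  proof -
    have "to_fract (mconst (\<omega> (\<lambda>i. qmon (J i))) :: ('k, 25) mpoly) = det (\<chi> i. quad_row (mat 1) (J i))" for J
      unfolding \<omega> mconst.C_det to_fract.C_det quad_row_mat_1
      by (intro arg_cong[of _ _ det]) (simp add: vec_eq_iff)
    then show ?thesis
      unfolding D_def gact_def to_fract.C_sum to_fract.C_mult to_fract.C_prod
      using det_quad_row_mult[of Y "mat 1" w] by (simp add: Y_def mult.commute)
  qed
  show ?thesis
  proof (rule ccontr)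
    assume "\<not> GIT_semistable \<omega>"
    with semistable_or_valuation[of 5 \<omega> 22] obtain I where I: "maximal_nonunital_subring I"
      "\<And>ws. length ws = 5 \<Longrightarrow> to_fract (prod_list (map (gact \<omega>) ws)) / to_fract (gdet ^ 22) \<in> I" by auto
    interpret maximal_nonunital_subring I by (rule I(1))
    obtain A where A: "\<And>i j. A $ i $ j \<in> Ov" "det (A ** Y) ^ 2 = det Y ^ 2"
        "\<And>i j. j < i \<Longrightarrow> (A ** Y) $ i $ j = 0"
      using triangularize_over_Ov[of Y UNIV] by blast
    define Z where "Z = A ** Y"
    have Z_tri: "Z $ i $ j = 0" if "j < i" for i j
      using A(3) that unfolding Z_def .
    \<comment> \<open>The tuple whose translated coordinate has least valuation.\<close>
    obtain w\<^sub>0 where w\<^sub>0: "\<And>w. \<exists>c\<in>Ov. D w = c * D w\<^sub>0"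
      using Ov_minimum[of UNIV D] by auto
    have "\<exists>c\<in>Ov. (\<Prod>a\<in>UNIV. Z $ a $ a) ^ 4 * (Z $ fst m $ fst m * Z $ snd m $ snd m) = c * D w\<^sub>0"
      if m: "texp (fst m) + texp (snd m) = 6" for m
    proof -
      obtain c where c: "\<And>w. c w \<in> Ov" "\<And>w. D w = c w * D w\<^sub>0" using w\<^sub>0 by metis
      let ?w = "\<lambda>i. basis_mon m (wt i)"
      let ?A = "\<lambda>J. \<Prod>i\<in>UNIV. A $ fst (?w i) $ fst (J i) * A $ snd (?w i) $ snd (J i)"
      have "(\<Prod>a\<in>UNIV. Z $ a $ a) ^ 4 * (Z $ fst m $ fst m * Z $ snd m $ snd m) = det (\<chi> i. quad_row Z (?w i))"
        using det_quad_row_triangular[of Z ?w, OF Z_tri basis_mon_weight[OF m]]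
        unfolding prod_basis_mon[of "\<lambda>a. Z $ a $ a"] by (rule sym)
      also have "\<dots> = (\<Sum>J\<in>UNIV. ?A J * D J)" unfolding Z_def det_quad_row_mult D_def ..
      also have "\<dots> = (\<Sum>J\<in>UNIV. ?A J * c J) * D w\<^sub>0"
        unfolding sum_distrib_right by (intro sum.cong refl, subst c(2)) (simp only: mult.assoc)
      finally show ?thesis
        by (intro bexI[of _ "\<Sum>J\<in>UNIV. ?A J * c J"]) (auto intro!: Ov_sum Ov_mult Ov_prod A c)
    qed
    from this[of "(0, 4)"] this[of "(1, 3)"] this[of "(2, 2)"]
    obtain a b c where abc: "a \<in> Ov" "b \<in> Ov" "c \<in> Ov"
      and a: "(\<Prod>a\<in>UNIV. Z $ a $ a) ^ 4 * (Z $ 0 $ 0 * Z $ 4 $ 4) = a * D w\<^sub>0"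
      and b: "(\<Prod>a\<in>UNIV. Z $ a $ a) ^ 4 * (Z $ 1 $ 1 * Z $ 3 $ 3) = b * D w\<^sub>0"
      and c: "(\<Prod>a\<in>UNIV. Z $ a $ a) ^ 4 * (Z $ 2 $ 2 * Z $ 2 $ 2) = c * D w\<^sub>0" by auto
    have det_Z: "det Z = (\<Prod>a\<in>UNIV. Z $ a $ a)"
      using A(3) unfolding Z_def by (intro det_upperdiagonal) auto
    have det_Y: "det Y = to_fract gdet"
    proof -
      have "Y = transpose (\<chi> i j. to_fract (gvar i j))" unfolding Y_def by (simp add: vec_eq_iff transpose_def)
      then show ?thesis unfolding gdet_def to_fract.C_det by (simp add: det_transpose)
    qed
    \<comment> \<open>The exponents 2, 2, 1 balance the characters: x_0 x_4 and x_1 x_3 taken twice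
      and x_2^2 taken once contain every variable twice, beside the 5 * 4 = 20 occurrences in the
      other monomials.\<close>
    have "(a ^ 2 * b ^ 2 * c) * D w\<^sub>0 ^ 5 = (a * D w\<^sub>0) ^ 2 * (b * D w\<^sub>0) ^ 2 * (c * D w\<^sub>0)"
      by (simp add: eval_nat_numeral mult_ac)
    also have "\<dots> = det Z ^ 22"
    proof -
      define P where "P = (\<Prod>a\<in>UNIV. Z $ a $ a)"
      have "P = Z $ 0 $ 0 * Z $ 1 $ 1 * Z $ 2 $ 2 * Z $ 3 $ 3 * Z $ 4 $ 4"
        unfolding P_def UNIV_5 by (simp add: mult_ac)
      then have "((P ^ 4) ^ 2 * (P ^ 4) ^ 2 * P ^ 4) * P ^ 2 = (P ^ 4 * (Z $ 0 $ 0 * Z $ 4 $ 4)) ^ 2 *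
          (P ^ 4 * (Z $ 1 $ 1 * Z $ 3 $ 3)) ^ 2 * (P ^ 4 * (Z $ 2 $ 2 * Z $ 2 $ 2))"
        by (simp add: power_mult_distrib power2_eq_square mult_ac)
      then show ?thesis unfolding a[symmetric] b[symmetric] c[symmetric] det_Z P_def[symmetric]
        by (simp flip: power_mult power_add)
    qed
    \<comment> \<open>The exponent 22 is even, so the sign lost in the triangularization does no
      harm.\<close>
    also have "\<dots> = (det Z ^ 2) ^ 11" by (simp flip: power_mult)
    also have "\<dots> = to_fract gdet ^ 22"
      unfolding A(2)[folded Z_def] det_Y by (simp flip: power_mult)
    finally have "(a ^ 2 * b ^ 2 * c) * D w\<^sub>0 ^ 5 = to_fract (gdet ^ 22)" by (simp add: to_fract.C_power)
    moreover have "(a ^ 2 * b ^ 2 * c) * (D w\<^sub>0 ^ 5 / to_fract (gdet ^ 22)) \<in> I"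
    proof (rule Ov_mult_I)
      show "a ^ 2 * b ^ 2 * c \<in> Ov" by (intro Ov_mult Ov_power abc)
      have "to_fract (prod_list (map (gact \<omega>) (replicate 5 w\<^sub>0))) = D w\<^sub>0 ^ 5"
        by (simp add: gact prod_list_replicate to_fract.C_power)
      with I(2)[of "replicate 5 w\<^sub>0"] show "D w\<^sub>0 ^ 5 / to_fract (gdet ^ 22) \<in> I" by simp
    qed
    moreover have "to_fract (gdet ^ 22) \<noteq> 0" using gdet_power_nonzero[of 22] by simp
    ultimately have "1 \<in> I" by simp
    with one_notin show False by blast
  qed
qed


subsection \<open>Polynomials along the two affine charts of the curve\<close>

interpretation pconst: coeff_hom "\<lambda>c. [:c:] :: 'k::comm_ring_1 poly"
  by unfold_locales (auto simp: one_pCons)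

text \<open>Restriction to the monomial curve with coordinates t^(e i). The chart s = 1 of the curve
  is given by \<open>texp\<close>, the chart t = 1 by 6 - \<open>texp\<close>.\<close>

definition along :: "(5 \<Rightarrow> nat) \<Rightarrow> ('k::field, 5) mpoly \<Rightarrow> 'k poly"
  where "along e = mpoly_subst (\<lambda>c. [:c:]) (\<lambda>i. monom 1 (e i))"

lemma poly_along: "poly (along e p) t = meval p (\<chi> i. t ^ e i)"
  unfolding along_def mpoly_subst_def meval_def
  by (simp add: poly_sum poly_prod poly_monom)

text \<open>For the constant e = 1 this is the degree, for \<open>texp\<close> the exponent of t on
  the curve; a third choice serves as termination measure when monomials are rewritten.\<close>

definition weight :: "(5 \<Rightarrow> nat) \<Rightarrow> (5 \<Rightarrow>\<^sub>0 nat) \<Rightarrow> nat"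
  where "weight e m = (\<Sum>i\<in>UNIV. e i * Poly_Mapping.lookup m i)"

lemma weight_add: "weight e (m + m') = weight e m + weight e m'"
  by (simp add: weight_def lookup_add distrib_left sum.distrib)

lemma weight_single [simp]: "weight e (Poly_Mapping.single i 1) = e i"
  by (simp add: weight_def lookup_single when_def if_distrib cong: if_cong)

lemma weight_expand:
  "weight e m = e 0 * Poly_Mapping.lookup m 0 + e 1 * Poly_Mapping.lookup m 1 + e 2 * Poly_Mapping.lookup m 2 +
    e 3 * Poly_Mapping.lookup m 3 + e 4 * Poly_Mapping.lookup m 4"
  unfolding weight_def UNIV_5 by simp

lemma forms_conv_weight: "p \<in> forms d \<longleftrightarrow> (\<forall>m\<in>Poly_Mapping.keys p. weight (\<lambda>_. 1) m = d)"
  by (simp add: forms_def weight_def)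

lemma along_conv_weight:
  "along e p = (\<Sum>m\<in>Poly_Mapping.keys p. monom (Poly_Mapping.lookup p m) (weight e m))"
proof -
  have "(\<Prod>i\<in>A. monom (1::'a) (f i)) = monom 1 (\<Sum>i\<in>A. f i)" for A and f :: "5 \<Rightarrow> nat"
    by (induction A rule: infinite_finite_induct) (auto simp: mult_monom)
  then show ?thesis
    unfolding along_def mpoly_subst_def weight_def
    by (simp add: monom_power smult_monom)
qed

lemma coeff_along:
  "coeff (along e p) k = (\<Sum>m\<in>Poly_Mapping.keys p. if weight e m = k then Poly_Mapping.lookup p m else 0)"
  unfolding along_conv_weight by (simp add: coeff_sum)

lemma along_qmon: "along e (qmon c) = monom 1 (e (fst c) + e (snd c))"
  unfolding along_def qmon_def pconst.mpoly_subst_mult pconst.mpoly_subst_mvar by (simp add: mult_monom)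

lemma along_add: "along e (p + q) = along e p + along e q"
  and along_mconst: "along e (mconst c * p) = smult c (along e p)"
  unfolding along_def by (simp_all add: pconst.mpoly_subst_add pconst.mpoly_subst_mult pconst.mpoly_subst_mconst)

lemma along_sum: "along e (sum f A) = (\<Sum>x\<in>A. along e (f x))"
proof -
  have "along e 0 = 0" by (simp add: along_def mpoly_subst_def)
  then show ?thesis by (induction A rule: infinite_finite_induct) (auto simp: along_add)
qed

text \<open>A monomial has weight 1 only if a variable of weight 1 occurs. The missing linear term
  is the trace of the cusp at the origin of the chart.\<close>

lemma coeff_along_1:
  assumes "\<And>i. e i \<noteq> 1"
  shows "coeff (along e p) 1 = 0"
proof -
  have "weight e m \<noteq> 1" for m
  proof
    assume "weight e m = 1"
    then obtain i where "e i * Poly_Mapping.lookup m i \<noteq> 0"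
      using sum.neutral[of UNIV "\<lambda>i. e i * Poly_Mapping.lookup m i"] unfolding weight_def by force
    moreover have "e i * Poly_Mapping.lookup m i \<le> weight e m"
      unfolding weight_def by (rule member_le_sum) auto
    ultimately have "e i * Poly_Mapping.lookup m i = 1" using \<open>weight e m = 1\<close> by linarith
    with assms[of i] show False by simp
  qed
  then show ?thesis unfolding coeff_along by simp
qed

lemma nu_affine: "nu 1 t = (\<chi> i. t ^ texp i)" "nu t 1 = (\<chi> i. t ^ (6 - texp i))"
  by (simp_all add: nu_def texp_def vec_eq_iff)

lemma all_5: "(\<forall>i::5. P i) \<longleftrightarrow> P 0 \<and> P 1 \<and> P 2 \<and> P 3 \<and> P 4"
proof -
  have "(\<forall>i::5. P i) \<longleftrightarrow> (\<forall>i\<in>{0,1,2,3,4}. P i)" unfolding UNIV_5[symmetric] by simp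
  then show ?thesis by simp
qed

lemma texp_not_1: "texp i \<noteq> 1" "6 - texp i \<noteq> 1"
  by (auto simp: texp_def)

lemma nu_scale: "s \<noteq> 0 \<Longrightarrow> nu s t = s ^ 6 *s nu 1 (t / s)" "t \<noteq> 0 \<Longrightarrow> nu s t = t ^ 6 *s nu (s / t) 1"
  unfolding vec_eq_iff all_5 by (simp_all add: nu_def field_simps eval_nat_numeral)

section \<open>Functions that are locally rational on a chart\<close>

lemma poly_eqI_nonzero:
  fixes p q :: "'k::field_char_0 poly"
  assumes "\<And>t. t \<noteq> 0 \<Longrightarrow> poly p t = poly q t"
  shows "p = q"
proof -
  have "poly ([:0, 1:] * (p - q)) t = 0" for t
    using assms[of t] by (cases "t = 0") auto
  then have "[:0, 1:] * (p - q) = 0" using poly_all_0_iff_0 by blast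
  then show ?thesis by simp
qed

text \<open>The polynomials b for which b h is a polynomial form an ideal without common zeros. A
  nonzero member of least degree divides all of them, so a root of it would be a common zero; hence
  it is constant and h is a polynomial A. Near 0, b A = a with b(0) nonzero, so the absent linear
  terms of a and b force that of A to vanish.\<close>

lemma locally_rational_imp_poly:
  fixes h :: "'k::{alg_closed_field, field_char_0} \<Rightarrow> 'k"
  assumes loc: "\<And>u. \<exists>a b. coeff a 1 = 0 \<and> coeff b 1 = 0 \<and> poly b u \<noteq> 0 \<and>
    (\<forall>t. poly b t \<noteq> 0 \<longrightarrow> h t = poly a t / poly b t)"
  shows "\<exists>A. coeff A 1 = 0 \<and> (\<forall>t. h t = poly A t)"
proof -
  define \<I> where "\<I> = {b. \<exists>a. \<forall>t. poly b t * h t = poly a t}"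
  have ex: "\<exists>b\<in>\<I>. poly b u \<noteq> 0" for u
  proof -
    obtain a b where ab: "poly b u \<noteq> 0" "\<And>t. poly b t \<noteq> 0 \<Longrightarrow> h t = poly a t / poly b t"
      using loc[of u] by blast
    \<comment> \<open>One more factor b makes the identity hold also at the zeros of b.\<close>
    have "poly (b * b) t * h t = poly (a * b) t" for t
      using ab(2)[of t] by (cases "poly b t = 0") auto
    then have "b * b \<in> \<I>" unfolding \<I>_def by blast
    then show ?thesis using ab(1) by (intro bexI[of _ "b * b"]) auto
  qed
  define P where "P n \<longleftrightarrow> (\<exists>b\<in>\<I>. b \<noteq> 0 \<and> degree b = n)" for n
  obtain b\<^sub>1 where b\<^sub>1: "b\<^sub>1 \<in> \<I>" "poly b\<^sub>1 0 \<noteq> 0" using ex by blast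
  then have "b\<^sub>1 \<noteq> 0" by auto
  with b\<^sub>1 have "P (degree b\<^sub>1)" unfolding P_def by blast
  then have "P (LEAST n. P n)" by (rule LeastI)
  then obtain b\<^sub>0 where b\<^sub>0: "b\<^sub>0 \<in> \<I>" "b\<^sub>0 \<noteq> 0" "degree b\<^sub>0 = (LEAST n. P n)" unfolding P_def by blast
  obtain a\<^sub>0 where a\<^sub>0: "\<And>t. poly b\<^sub>0 t * h t = poly a\<^sub>0 t" using b\<^sub>0(1) unfolding \<I>_def by blast
  have "degree b\<^sub>0 = 0"
  proof (rule ccontr)
    assume "degree b\<^sub>0 \<noteq> 0"
    then obtain u where u: "poly b\<^sub>0 u = 0" using alg_closed_imp_poly_has_root[of b\<^sub>0] by auto
    obtain b where b: "b \<in> \<I>" "poly b u \<noteq> 0" using ex by blast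
    obtain a where a: "\<And>t. poly b t * h t = poly a t" using b(1) unfolding \<I>_def by blast
    have "poly (b mod b\<^sub>0) t * h t = poly (a - (b div b\<^sub>0) * a\<^sub>0) t" for t
    proof -
      have "poly (b mod b\<^sub>0) t = poly b t - poly (b div b\<^sub>0) t * poly b\<^sub>0 t"
      proof -
        have "poly b t = poly (b div b\<^sub>0 * b\<^sub>0 + b mod b\<^sub>0) t" by (simp only: div_mult_mod_eq)
        then show ?thesis unfolding poly_add poly_mult by simp
      qed
      then show ?thesis using a[of t] a\<^sub>0[of t] by (simp add: left_diff_distrib mult.assoc)
    qed
    then have "b mod b\<^sub>0 \<in> \<I>" unfolding \<I>_def by blast
    then have "b mod b\<^sub>0 = 0"
      using degree_mod_less[OF b\<^sub>0(2), of b] not_less_Least[of "degree (b mod b\<^sub>0)" P] b\<^sub>0(3)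
      unfolding P_def by metis
    then have "b\<^sub>0 dvd b" by auto
    then show False using u b(2) by (auto elim!: dvdE)
  qed
  then obtain c where c: "b\<^sub>0 = [:c:]" using degree_eq_zeroE by blast
  define A where "A = smult (inverse c) a\<^sub>0"
  have hA: "h t = poly A t" for t
    using a\<^sub>0[of t] b\<^sub>0(2) unfolding c A_def by (auto simp: field_simps)
  obtain a b where ab: "coeff a 1 = 0" "coeff b 1 = 0" "poly b 0 \<noteq> 0"
      "\<And>t. poly b t \<noteq> 0 \<Longrightarrow> h t = poly a t / poly b t"
    using loc[of 0] by blast
  have "poly (b * (b * A - a)) t = 0" for t
    using ab(4)[of t] hA[of t] by (cases "poly b t = 0") (auto simp: field_simps)
  then have "b * (b * A - a) = 0" using poly_all_0_iff_0 by blast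
  then have "b * A = a" using ab(3) by auto
  then have "coeff b 0 * coeff A 1 + coeff b 1 * coeff A 0 = 0"
    using ab(1) by (auto simp: coeff_mult)
  then have "coeff A 1 = 0" using ab(2,3) by (simp add: poly_0_coeff_0)
  with hA show ?thesis by blast
qed


subsection \<open>The sections of degree two\<close>

lemma meval_mult: "meval (p * q) v = meval p v * meval q v"
  and meval_add: "meval (p + q) v = meval p v + meval q v"
  and meval_diff: "meval (p - q) v = meval p v - meval q v"
  and meval_1: "meval 1 v = 1"
  and meval_power: "meval (p ^ n) v = meval p v ^ n"
  and meval_mconst: "meval (mconst c) v = c"
  and meval_mvar: "meval (mvar i) v = v $ i"
  by (simp_all add: meval_conv_subst meval.C_mult meval.C_add meval.C_diff meval.C_power
      coeff_hom.mpoly_subst_mconst[OF coeff_hom_id] coeff_hom.mpoly_subst_mvar[OF coeff_hom_id])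

lemma meval_scale:
  assumes "p \<in> forms d"
  shows "meval p (c *s v) = c ^ d * meval p v"
  unfolding meval_def sum_distrib_left
proof (intro sum.cong refl)
  fix m assume "m \<in> Poly_Mapping.keys p"
  then have "(\<Sum>i\<in>UNIV. Poly_Mapping.lookup m i) = d" using assms unfolding forms_def by blast
  then have "(\<Prod>i\<in>UNIV. c ^ Poly_Mapping.lookup m i) = c ^ d" by (simp flip: power_sum)
  then show "Poly_Mapping.lookup p m * (\<Prod>i\<in>UNIV. (c *s v) $ i ^ Poly_Mapping.lookup m i) =
      c ^ d * (Poly_Mapping.lookup p m * (\<Prod>i\<in>UNIV. v $ i ^ Poly_Mapping.lookup m i))"
    by (simp add: power_mult_distrib prod.distrib)
qed

lemma nu_in_C0: "s \<noteq> 0 \<or> t \<noteq> 0 \<Longrightarrow> nu s t \<in> C0"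
  unfolding C0_def by (intro CollectI exI[of _ 1] exI[of _ s] exI[of _ t]) auto

lemma scale_in_C0: "v \<in> C0 \<Longrightarrow> c \<noteq> 0 \<Longrightarrow> c *s v \<in> C0"
  unfolding C0_def by (auto simp: vector_smult_assoc) (metis mult_eq_0_iff)+

lemma C0_cases:
  assumes "v \<in> C0"
  obtains c s where "c \<noteq> 0" "v = c *s nu s 1" | c t where "c \<noteq> 0" "v = c *s nu 1 t"
proof -
  obtain c s t where v: "c \<noteq> 0" "(s, t) \<noteq> (0, 0)" "v = c *s nu s t" using assms unfolding C0_def by blast
  show ?thesis
  proof (cases "s = 0")
    case True
    then have "v = (c * t ^ 6) *s nu (s / t) 1" "c * t ^ 6 \<noteq> 0"
      using v nu_scale(2)[of t s] by (auto simp: vector_smult_assoc)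
    then show ?thesis using that by blast
  next
    case False
    then have "v = (c * s ^ 6) *s nu 1 (t / s)" "c * s ^ 6 \<noteq> 0"
      using v nu_scale(1)[of s t] by (auto simp: vector_smult_assoc)
    then show ?thesis using that by blast
  qed
qed

lemma twisted_section_scale:
  assumes f: "f \<in> twisted_sections C0 2" and v: "v \<in> C0" and c: "c \<noteq> 0"
  shows "f (c *s v) = c ^ 2 * f v"
proof -
  obtain e P Q where PQ: "P \<in> forms (e + 2)" "Q \<in> forms e" "meval Q v \<noteq> 0"
      "\<And>u. u \<in> C0 \<Longrightarrow> meval Q u \<noteq> 0 \<Longrightarrow> f u = meval P u / meval Q u"
    using f v unfolding twisted_sections_def by blast
  have "f (c *s v) = meval P (c *s v) / meval Q (c *s v)"
    using PQ c v by (intro PQ(4) scale_in_C0) (auto simp: meval_scale)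
  also have "\<dots> = c ^ 2 * (meval P v / meval Q v)"
    using c by (simp add: meval_scale[OF PQ(1)] meval_scale[OF PQ(2)] power_add power2_eq_square)
  also have "\<dots> = c ^ 2 * f v" using PQ(4)[OF v PQ(3)] by simp
  finally show ?thesis .
qed

lemma twisted_section_chart:
  fixes f :: "'k::{alg_closed_field, field_char_0} ^ 5 \<Rightarrow> 'k"
  assumes f: "f \<in> twisted_sections C0 2" and \<gamma>: "\<And>t :: 'k. (\<chi> i. t ^ e i) \<in> C0" and e: "\<And>i. e i \<noteq> 1"
  shows "\<exists>A. coeff A 1 = 0 \<and> (\<forall>t. f (\<chi> i. t ^ e i) = poly A t)"
proof (rule locally_rational_imp_poly)
  fix u :: 'k
  obtain d P Q where PQ: "P \<in> forms (d + 2)" "Q \<in> forms d" "meval Q (\<chi> i. u ^ e i) \<noteq> 0"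
      "\<And>v. v \<in> C0 \<Longrightarrow> meval Q v \<noteq> 0 \<Longrightarrow> f v = meval P v / meval Q v"
    using f \<gamma>[of u] unfolding twisted_sections_def by blast
  then have "coeff (along e P) 1 = 0 \<and> coeff (along e Q) 1 = 0 \<and> poly (along e Q) u \<noteq> 0 \<and>
      (\<forall>t. poly (along e Q) t \<noteq> 0 \<longrightarrow> f (\<chi> i. t ^ e i) = poly (along e P) t / poly (along e Q) t)"
    using \<gamma> by (simp add: poly_along coeff_along_1[of e, OF e] del: One_nat_def)
  then show "\<exists>a b. coeff a 1 = 0 \<and> coeff b 1 = 0 \<and> poly b u \<noteq> 0 \<and>
      (\<forall>t. poly b t \<noteq> 0 \<longrightarrow> f (\<chi> i. t ^ e i) = poly a t / poly b t)" by blast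
qed

text \<open>On the overlap \<open>nu t 1\<close> is t^6 times \<open>nu 1 (1 / t)\<close>, and a
  section of degree two turns the factor t^6 into t^12.\<close>

lemma twisted_section_charts:
  fixes f :: "'k::{alg_closed_field, field_char_0} ^ 5 \<Rightarrow> 'k"
  assumes f: "f \<in> twisted_sections C0 2"
  obtains A A' where "coeff A 1 = 0" "\<And>t. f (nu 1 t) = poly A t"
    and "coeff A' 1 = 0" "\<And>t. f (nu t 1) = poly A' t"
    and "\<And>t. t \<noteq> 0 \<Longrightarrow> poly A' t = t ^ 12 * poly A (inverse t)"
proof -
  obtain A where A: "coeff A 1 = 0" "\<And>t. f (nu 1 t) = poly A t"
    using twisted_section_chart[OF f, of texp] nu_in_C0[of 1] texp_not_1 unfolding nu_affine by auto
  obtain A' where A': "coeff A' 1 = 0" "\<And>t. f (nu t 1) = poly A' t"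
    using twisted_section_chart[OF f, of "\<lambda>i. 6 - texp i"] nu_in_C0[of _ 1] texp_not_1 unfolding nu_affine by auto
  have "poly A' t = t ^ 12 * poly A (inverse t)" if "t \<noteq> 0" for t
  proof -
    have "poly A' t = f (t ^ 6 *s nu 1 (1 / t))" using nu_scale(1)[OF that, of 1] A'(2)[of t] by simp
    also have "\<dots> = (t ^ 6) ^ 2 * f (nu 1 (1 / t))"
      using that by (intro twisted_section_scale[OF f] nu_in_C0) auto
    finally show ?thesis using A(2) by (simp add: inverse_eq_divide flip: power_mult)
  qed
  then show ?thesis using that A A' by blast
qed

text \<open>Up to scalars the chart s = 1 misses only the point \<open>nu 0 1\<close>; there the
  polynomials of the other chart agree because they agree for all nonzero t.\<close>

lemma twisted_section_eqI:
  fixes f g :: "'k::{alg_closed_field, field_char_0} ^ 5 \<Rightarrow> 'k"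
  assumes f: "f \<in> twisted_sections C0 2" and g: "g \<in> twisted_sections C0 2"
    and eq: "\<And>t. f (nu 1 t) = g (nu 1 t)"
  shows "f = g"
proof
  fix v
  obtain A A' where A: "\<And>t. f (nu 1 t) = poly A t" "\<And>t. f (nu t 1) = poly A' t"
    "\<And>t. t \<noteq> 0 \<Longrightarrow> poly A' t = t ^ 12 * poly A (inverse t)" using twisted_section_charts[OF f] by metis
  obtain B B' where B: "\<And>t. g (nu 1 t) = poly B t" "\<And>t. g (nu t 1) = poly B' t"
    "\<And>t. t \<noteq> 0 \<Longrightarrow> poly B' t = t ^ 12 * poly B (inverse t)" using twisted_section_charts[OF g] by metis
  have "poly A t = poly B t" for t using A(1) B(1) eq by metis
  then have "A' = B'" by (intro poly_eqI_nonzero) (simp add: A(3) B(3))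
  show "f v = g v"
  proof (cases "v \<in> C0")
    case True
    then show ?thesis
    proof (cases rule: C0_cases)
      case (1 c s)
      then show ?thesis
        using twisted_section_scale[OF f] twisted_section_scale[OF g] nu_in_C0[of s 1] A(2) B(2) \<open>A' = B'\<close> by auto
    next
      case (2 c t)
      then show ?thesis
        using twisted_section_scale[OF f] twisted_section_scale[OF g] nu_in_C0[of 1 t] eq by auto
    qed
  next
    case False
    then show ?thesis using f g unfolding twisted_sections_def by auto
  qed
qed

text \<open>The gluing makes the second chart polynomial the reversal of A in degree 12. Hence A has
  degree at most 12, and the cusp at infinity, the missing linear term of the second polynomial,
  removes t^11.\<close>

lemma twisted_section_coeffs:
  fixes f :: "'k::{alg_closed_field, field_char_0} ^ 5 \<Rightarrow> 'k"
  assumes f: "f \<in> twisted_sections C0 2"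
  obtains A where "\<And>t. f (nu 1 t) = poly A t" "\<And>k. k \<notin> wts \<Longrightarrow> coeff A k = 0"
proof -
  obtain A A' where A: "coeff A 1 = 0" "\<And>t. f (nu 1 t) = poly A t" and A': "coeff A' 1 = 0"
    and AA': "\<And>t. t \<noteq> 0 \<Longrightarrow> poly A' t = t ^ 12 * poly A (inverse t)"
    using twisted_section_charts[OF f] by metis
  define n where "n = degree A"
  \<comment> \<open>Multiplying by t^n clears negative exponents. The coefficient of A at k stands
    at n - k + 12 on the right: for k > 12 this is below the lowest exponent n on the left, and for
    k = 11 it is n + 1, the linear coefficient of A'.\<close>
  have "monom 1 n * A' = monom 1 12 * reflect_poly A"
    by (rule poly_eqI_nonzero) (simp add: poly_monom AA' poly_reflect_poly_nz n_def)
  then have coeff_eq: "coeff (monom 1 n * A') k = coeff (monom 1 12 * reflect_poly A) k" for k by simp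
  have "coeff A k = 0" if "k > 12" for k
  proof (cases "k \<le> n")
    case True
    then have "coeff (monom 1 n * A') (n - k + 12) = 0" using that by (simp add: coeff_monom_mult)
    moreover have "\<not> degree A < degree A - k" by simp
    ultimately show ?thesis unfolding coeff_eq using True
      by (simp add: coeff_monom_mult coeff_reflect_poly n_def)
  qed (simp add: n_def coeff_eq_0)
  moreover have "coeff A 11 = 0"
  proof (cases "11 \<le> n")
    case True
    then have "coeff (monom 1 n * A') (n + 1) = 0" using A'(1) by (simp add: coeff_monom_mult)
    moreover have "\<not> degree A < degree A - 11" by simp
    ultimately show ?thesis unfolding coeff_eq using True
      by (simp add: coeff_monom_mult coeff_reflect_poly n_def)
  qed (simp add: n_def coeff_eq_0)
  moreover have "k > 12 \<or> k = 11 \<or> k = 1" if "k \<notin> wts" for k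
    using that unfolding wts_def by simp presburger
  ultimately show ?thesis using that[of A] A by metis
qed

text \<open>For k in \<open>wts\<close>, a monomial representing the weight k; in weight 6 the
  choice x_0 x_4 is one of three.\<close>

definition wt_form :: "nat \<Rightarrow> ('k::comm_ring_1, 5) mpoly"
  where "wt_form k = qmon (basis_mon (0, 4) k)"

lemma wt_form_in_forms: "wt_form k \<in> forms 2"
  unfolding wt_form_def by (rule qmon_in_forms)

lemma along_wt_form: "k \<in> wts \<Longrightarrow> along texp (wt_form k) = monom 1 k"
  unfolding wt_form_def along_qmon wts_def by (auto simp: basis_mon_def eval_nat_numeral)

lemma restrict_form_in_twisted_sections:
  assumes "p \<in> forms 2"
  shows "restrict_form C0 p \<in> twisted_sections C0 2"
  unfolding twisted_sections_def
proof (intro CollectI conjI allI ballI impI)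
  show "v \<notin> C0 \<Longrightarrow> restrict_form C0 p v = 0" for v by (simp add: restrict_form_def)
next
  fix v :: "'a ^ 5" assume "v \<in> C0"
  have "1 \<in> forms 0" by (simp add: forms_def)
  then show "\<exists>e. \<exists>P\<in>forms (e + 2). \<exists>Q\<in>forms e. meval Q v \<noteq> 0 \<and>
      (\<forall>u\<in>C0. meval Q u \<noteq> 0 \<longrightarrow> restrict_form C0 p u = meval P u / meval Q u)"
    using assms
    by (intro exI[of _ 0], rule_tac bexI[of _ p], rule_tac bexI[of _ 1]) (auto simp: meval_1 restrict_form_def simp flip: numeral_2_eq_2)
qed

lemma restrict_form_nu: "restrict_form C0 p (nu 1 t) = poly (along texp p) t"
  by (simp add: restrict_form_def nu_in_C0 poly_along nu_affine(1)[symmetric])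

lemma restrict_form_linear:
  "restrict_form C (mconst a * p + mconst b * q) = fun_scale a (restrict_form C p) + fun_scale b (restrict_form C q)"
  by (auto simp: fun_eq_iff restrict_form_def fun_scale_def meval_add meval_mult meval_mconst)

lemma restrict_form_sum:
  "restrict_form C (\<Sum>k\<in>A. mconst (c k) * p k) = (\<Sum>k\<in>A. fun_scale (c k) (restrict_form C (p k)))"
proof (induction A rule: infinite_finite_induct)
  case (insert x A)
  then show ?case
    using restrict_form_linear[of C "c x" "p x" 1 "\<Sum>k\<in>A. mconst (c k) * p k"]
    by (simp add: fun_scale_def)
qed (simp_all add: restrict_form_def meval_def fun_eq_iff)

text \<open>The monomials reach every weight in \<open>wts\<close>, so a quadric with the same chart
  polynomial as f can be written down, and agreement on one chart is equality.\<close>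

lemma twisted_section_expand:
  fixes f :: "'k::{alg_closed_field, field_char_0} ^ 5 \<Rightarrow> 'k"
  assumes f: "f \<in> twisted_sections C0 2"
  obtains c where "f = restrict_form C0 (\<Sum>k\<in>wts. mconst (c k) * wt_form k)"
proof -
  interpret module "mscale :: 'k \<Rightarrow> ('k, 5) mpoly \<Rightarrow> _" by (rule module_mscale)
  obtain A where A: "\<And>t. f (nu 1 t) = poly A t" "\<And>k. k \<notin> wts \<Longrightarrow> coeff A k = 0"
    using twisted_section_coeffs[OF f] by blast
  let ?p = "\<Sum>k\<in>wts. mconst (coeff A k) * wt_form k"
  have "coeff (\<Sum>k\<in>wts. monom (coeff A k) k) j = coeff A j" for j
    using A(2)[of j] by (simp add: coeff_sum wts_def)
  then have "along texp ?p = A"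
    by (intro poly_eqI) (simp add: along_sum along_mconst along_wt_form smult_monom)
  then have "f (nu 1 t) = restrict_form C0 ?p (nu 1 t)" for t
    by (simp add: A(1) restrict_form_nu)
  moreover have "?p \<in> forms 2"
    unfolding mscale_def[symmetric]
    by (intro subspace_sum[OF subspace_forms] subspace_scale[OF subspace_forms] wt_form_in_forms)
  ultimately have "f = restrict_form C0 ?p"
    by (intro twisted_section_eqI f restrict_form_in_twisted_sections)
  then show ?thesis using that by blast
qed

lemma restrict_forms_eq_twisted_sections:
  "restrict_form C0 ` forms 2 = twisted_sections (C0 :: ('k::{alg_closed_field, field_char_0} ^ 5) set) 2"
proof (intro equalityI subsetI)
  fix f :: "'k ^ 5 \<Rightarrow> 'k" assume "f \<in> twisted_sections C0 2"
  then obtain c where f: "f = restrict_form C0 (\<Sum>k\<in>wts. mconst (c k) * wt_form k)"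
    by (rule twisted_section_expand)
  interpret module "mscale :: 'k \<Rightarrow> ('k, 5) mpoly \<Rightarrow> _" by (rule module_mscale)
  have "(\<Sum>k\<in>wts. mscale (c k) (wt_form k)) \<in> forms 2"
    by (intro subspace_sum[OF subspace_forms] subspace_scale[OF subspace_forms] wt_form_in_forms)
  then show "f \<in> restrict_form C0 ` forms 2" unfolding f mscale_def by blast
qed (auto intro: restrict_form_in_twisted_sections)

text \<open>Read off from the chart polynomial, which is unique since the field is infinite; thus
  the coordinates depend on the section and not on a quadric restricting to it.\<close>

definition section_coords :: "('k::{alg_closed_field, field_char_0} ^ 5 \<Rightarrow> 'k) \<Rightarrow> 'k ^ 11"
  where "section_coords f = (\<chi> j. coeff (THE A. \<forall>t. f (nu 1 t) = poly A t) (wt j))"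

lemma section_coords_restrict: "section_coords (restrict_form C0 p) = (\<chi> j. coeff (along texp p) (wt j))"
proof -
  have "(THE A. \<forall>t. restrict_form C0 p (nu 1 t) = poly A t) = along texp p"
  proof (rule the_equality)
    fix A assume "\<forall>t. restrict_form C0 p (nu 1 t) = poly A t"
    then have "poly A = poly (along texp p)" by (auto simp: restrict_form_nu)
    then show "A = along texp p" using poly_eq_poly_eq_iff by blast
  qed (simp add: restrict_form_nu)
  then show ?thesis by (simp add: section_coords_def)
qed

lemma section_coords_linear:
  fixes f g :: "'k::{alg_closed_field, field_char_0} ^ 5 \<Rightarrow> 'k"
  assumes "f \<in> twisted_sections C0 2" "g \<in> twisted_sections C0 2"
  shows "section_coords (fun_scale a f + fun_scale b g) = a *s section_coords f + b *s section_coords g"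
proof -
  obtain p q where "f = restrict_form C0 p" "g = restrict_form C0 q"
    using assms unfolding restrict_forms_eq_twisted_sections[symmetric] by blast
  moreover have "section_coords (fun_scale a (restrict_form C0 p) + fun_scale b (restrict_form C0 q)) =
      a *s section_coords (restrict_form C0 p) + b *s section_coords (restrict_form C0 q)"
    unfolding restrict_form_linear[symmetric] section_coords_restrict
    by (simp add: vec_eq_iff along_add along_mconst)
  ultimately show ?thesis by simp
qed

lemma alternating_form_comp:
  assumes \<omega>: "alternating_form sc' UNIV \<omega>"
    and lin: "\<And>a b x y. x \<in> V \<Longrightarrow> y \<in> V \<Longrightarrow> \<phi> (sc a x + sc b y) = sc' a (\<phi> x) + sc' b (\<phi> y)"
  shows "alternating_form sc V (\<lambda>w. \<omega> (\<lambda>i. \<phi> (w i)))"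
proof -
  have upd: "(\<lambda>j. \<phi> ((w(i := x)) j)) = (\<lambda>j. \<phi> (w j))(i := \<phi> x)" for w i x by auto
  show ?thesis
    using \<omega> unfolding alternating_form_def upd by (simp add: lin)
qed

text \<open>The isomorphism of the top exterior power of the sections with the field, normalized on
  the basis of restricted monomials; it takes the role of \<delta> in
  \<open>second_Hilbert_point\<close>.\<close>

definition hilbert_form :: "(11 \<Rightarrow> 'k::{alg_closed_field, field_char_0} ^ 5 \<Rightarrow> 'k) \<Rightarrow> 'k"
  where "hilbert_form f = det (\<chi> i. section_coords (f i))"

lemma section_coords_basis:
  "section_coords (restrict_form C0 (wt_form (wt i))) = (\<chi> j. if j = i then 1 else 0)"
proof -
  have "wt i \<in> wts" using bij_betw_wt by (auto simp: bij_betw_def)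
  moreover have "wt i = wt j \<longleftrightarrow> j = i" for j using strict_mono_eq[OF strict_mono_wt] by auto
  ultimately show ?thesis by (simp add: section_coords_restrict along_wt_form)
qed

text \<open>The eleven restricted monomials have the unit vectors as coordinates, which makes them
  independent.\<close>

lemma dim_twisted_sections:
  "vector_space.dim fun_scale (twisted_sections (C0 :: ('k::{alg_closed_field, field_char_0} ^ 5) set) 2) = 11"
proof -
  interpret vector_space "fun_scale :: 'k \<Rightarrow> ('k ^ 5 \<Rightarrow> 'k) \<Rightarrow> _"
    by unfold_locales (auto simp: fun_scale_def fun_eq_iff algebra_simps)
  define u where "u i = restrict_form (C0 :: ('k ^ 5) set) (wt_form (wt i))" for i
  have coords: "section_coords (\<Sum>i\<in>UNIV. fun_scale (c i) (u i)) = (\<chi> i. c i)" for c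
  proof -
    have "section_coords (\<Sum>i\<in>UNIV. fun_scale (c i) (u i)) =
        (\<chi> j. \<Sum>i\<in>UNIV. c i * section_coords (u i) $ j)"
      unfolding u_def restrict_form_sum[symmetric] section_coords_restrict
      by (simp add: along_sum along_mconst coeff_sum)
    then show ?thesis
      by (simp add: u_def section_coords_basis vec_eq_iff if_distrib cong: if_cong)
  qed
  have inj: "inj u"
  proof (rule injI)
    fix i j assume "u i = u j"
    then have "section_coords (u i) $ i = section_coords (u j) $ i" by simp
    then show "i = j" by (simp add: u_def section_coords_basis split: if_splits)
  qed
  have indep: "independent (range u)"
  proof (rule independent_if_scalars_zero)
    fix c x assume 0: "(\<Sum>x\<in>range u. fun_scale (c x) x) = 0" and x: "x \<in> range u"
    then obtain i where i: "x = u i" by blast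
    have "(\<Sum>i\<in>UNIV. fun_scale (c (u i)) (u i)) = 0"
      using 0 inj by (simp add: sum.reindex)
    moreover have "section_coords (0 :: 'k ^ 5 \<Rightarrow> 'k) = (\<chi> i. 0)"
      using coords[of "\<lambda>_. 0"] by simp
    ultimately have "(\<chi> i. c (u i)) = (\<chi> i. (0::'k))" using coords[of "\<lambda>i. c (u i)"] by simp
    then show "c x = 0" unfolding i by (simp add: vec_eq_iff)
  qed simp
  have "twisted_sections C0 2 \<subseteq> span (range u)"
  proof
    fix f :: "'k ^ 5 \<Rightarrow> 'k" assume "f \<in> twisted_sections C0 2"
    then obtain c where f: "f = restrict_form C0 (\<Sum>k\<in>wts. mconst (c k) * wt_form k)"
      by (rule twisted_section_expand)
    have "(\<Sum>i\<in>UNIV. fun_scale (c (wt i)) (u i)) \<in> span (range u)"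
      by (intro span_sum span_scale span_base rangeI)
    moreover have "f = (\<Sum>i\<in>UNIV. fun_scale (c (wt i)) (u i))"
      unfolding f u_def restrict_form_sum by (rule sum.reindex_bij_betw[OF bij_betw_wt, symmetric])
    ultimately show "f \<in> span (range u)" by simp
  qed
  moreover have "range u \<subseteq> twisted_sections C0 2"
    unfolding u_def by (auto intro: restrict_form_in_twisted_sections wt_form_in_forms)
  moreover have "card (range u) = 11" using inj by (simp add: card_image)
  ultimately show ?thesis using dim_unique indep by blast
qed

lemma two_Hilbert_semistable_C0:
  "two_Hilbert_semistable (C0 :: ('k::{alg_closed_field, field_char_0} ^ 5) set)"
proof -
  let ?C = "C0 :: ('k ^ 5) set"
  let ?\<omega> = "\<lambda>w :: 11 \<Rightarrow> ('k, 5) mpoly. hilbert_form (\<lambda>i. restrict_form ?C (w i))"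
  have "alternating_form fun_scale (twisted_sections ?C 2) hilbert_form"
    unfolding hilbert_form_def
    by (rule alternating_form_comp[where \<omega> = "\<lambda>r. det (\<chi> i. r i)" and \<phi> = section_coords])
      (rule alternating_form_det section_coords_linear; assumption)+
  moreover have "\<exists>u. range u \<subseteq> twisted_sections ?C 2 \<and> hilbert_form u \<noteq> 0"
  proof (intro exI conjI)
    show "range (\<lambda>i. restrict_form ?C (wt_form (wt i))) \<subseteq> twisted_sections ?C 2"
      by (auto intro: restrict_form_in_twisted_sections wt_form_in_forms)
    have "(\<chi> i. section_coords (restrict_form ?C (wt_form (wt i)))) = mat 1"
      unfolding section_coords_basis by (auto simp: mat_def vec_eq_iff)
    then show "hilbert_form (\<lambda>i. restrict_form ?C (wt_form (wt i))) \<noteq> 0"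
      by (simp add: hilbert_form_def)
  qed
  ultimately have "second_Hilbert_point ?C ?\<omega>"
    unfolding second_Hilbert_point_def restrict_forms_eq_twisted_sections dim_twisted_sections by auto
  moreover have "GIT_semistable ?\<omega>"
  proof (rule cuspidal_GIT_semistable)
    fix J :: "11 \<Rightarrow> 5 \<times> 5"
    show "?\<omega> (\<lambda>i. qmon (J i)) = det (\<chi> i j. if texp (fst (J i)) + texp (snd (J i)) = wt j then 1 else 0)"
      unfolding hilbert_form_def section_coords_restrict along_qmon
      by (intro arg_cong[of _ _ det]) (simp add: vec_eq_iff)
  qed
  ultimately show ?thesis unfolding two_Hilbert_semistable_def by blast
qed


subsection \<open>The homogeneous ideal\<close>

definition cusp_quadrics :: "('k::comm_ring_1, 5) mpoly set"
  where "cusp_quadrics = {mvar 3 ^ 2 - mvar 1 * mvar 4, mvar 1 * mvar 3 - mvar 0 * mvar 4,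
    mvar 2 ^ 2 - mvar 0 * mvar 4, mvar 1 ^ 2 - mvar 0 * mvar 3}"

lemma module_mult: "module ((*) :: 'a::comm_ring_1 \<Rightarrow> 'a \<Rightarrow> 'a)"
  by unfold_locales (auto simp: algebra_simps)

text \<open>Divisible by none of x_1^2, x_2^2, x_3^2, x_1 x_3, which are taken as the leading
  monomials of the four quadrics: a normal form for monomials modulo the ideal.\<close>

definition reduced :: "(5 \<Rightarrow>\<^sub>0 nat) \<Rightarrow> bool"
  where "reduced m \<longleftrightarrow> Poly_Mapping.lookup m 1 \<le> 1 \<and> Poly_Mapping.lookup m 2 \<le> 1 \<and>
    Poly_Mapping.lookup m 3 \<le> 1 \<and> (Poly_Mapping.lookup m 1 = 0 \<or> Poly_Mapping.lookup m 3 = 0)"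

text \<open>The weights of $1, x_1, x_2, x_3, x_1x_2, x_2x_3$ are distinct modulo 6, the weight of $x_4$.\<close>

lemma reduced_unique:
  assumes "reduced m" "reduced m'" "weight (\<lambda>_. 1) m = weight (\<lambda>_. 1) m'" "weight texp m = weight texp m'"
  shows "m = m'"
proof -
  let ?l = Poly_Mapping.lookup
  have d: "?l m 0 + ?l m 1 + ?l m 2 + ?l m 3 + ?l m 4 = ?l m' 0 + ?l m' 1 + ?l m' 2 + ?l m' 3 + ?l m' 4"
    and w: "2 * ?l m 1 + 3 * ?l m 2 + 4 * ?l m 3 + 6 * ?l m 4 =
      2 * ?l m' 1 + 3 * ?l m' 2 + 4 * ?l m' 3 + 6 * ?l m' 4"
    using assms(3,4) unfolding weight_expand by simp_all
  have range: "(?l m 1, ?l m 2, ?l m 3) \<in> {(0,0,0), (1,0,0), (0,1,0), (0,0,1), (1,1,0), (0,1,1)}"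
    if "reduced m" for m using that unfolding reduced_def by auto
  have "(2 * ?l m 1 + 3 * ?l m 2 + 4 * ?l m 3) mod 6 = (2 * ?l m' 1 + 3 * ?l m' 2 + 4 * ?l m' 3) mod 6"
    using arg_cong[OF w, of "\<lambda>x. x mod 6"] by simp
  then have "?l m 1 = ?l m' 1 \<and> ?l m 2 = ?l m' 2 \<and> ?l m 3 = ?l m' 3"
    using range[OF assms(1)] range[OF assms(2)] by auto
  then have "\<forall>i. ?l m i = ?l m' i" unfolding all_5 using d w by simp
  then show ?thesis by (simp add: poly_mapping_eq_iff fun_eq_iff)
qed

text \<open>One rewriting by a binomial quadric. Degree and weight are preserved as the binomial is
  homogeneous for both; the decrease of \<mu> ensures termination.\<close>

lemma reduce_step:
  fixes m :: "5 \<Rightarrow>\<^sub>0 nat"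
  assumes gen: "(mvar a * mvar b - mvar c * mvar d :: ('k::comm_ring_1, 5) mpoly) \<in> ideal_generated G"
    and le: "m = r + (Poly_Mapping.single a 1 + Poly_Mapping.single b 1)"
    and e: "texp a + texp b = texp c + texp d" and \<mu>: "\<mu> c + \<mu> d < \<mu> a + \<mu> b"
  shows "\<exists>m'. weight (\<lambda>_. 1) m' = weight (\<lambda>_. 1) m \<and> weight texp m' = weight texp m \<and> weight \<mu> m' < weight \<mu> m \<and>
    (Poly_Mapping.single m 1 - Poly_Mapping.single m' 1 :: ('k, 5) mpoly) \<in> ideal_generated G"
proof (intro exI conjI)
  interpret module "(*) :: ('k, 5) mpoly \<Rightarrow> _" by (rule module_mult)
  let ?m' = "r + (Poly_Mapping.single c 1 + Poly_Mapping.single d 1)"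
  have "(Poly_Mapping.single m 1 - Poly_Mapping.single ?m' 1 :: ('k, 5) mpoly) =
      Poly_Mapping.single r 1 * (mvar a * mvar b - mvar c * mvar d)"
    unfolding le mvar_def by (simp add: right_diff_distrib mult_single)
  then show "(Poly_Mapping.single m 1 - Poly_Mapping.single ?m' 1 :: ('k, 5) mpoly) \<in> ideal_generated G"
    using span_scale gen unfolding ideal_generated_def by metis
qed (use e \<mu> in \<open>simp_all add: le weight_add del: One_nat_def\<close>)

lemma reduce_monomial:
  fixes m :: "5 \<Rightarrow>\<^sub>0 nat"
  shows "\<exists>m'. reduced m' \<and> weight (\<lambda>_. 1) m' = weight (\<lambda>_. 1) m \<and> weight texp m' = weight texp m \<and>
    (Poly_Mapping.single m 1 - Poly_Mapping.single m' 1 :: ('k::comm_ring_1, 5) mpoly) \<in> ideal_generated cusp_quadrics"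
proof -
  \<comment> \<open>Counts the factors x_1, x_2, x_3. Each quadric trades two of them for one or
    none: x_1^2 for x_0 x_3, x_3^2 for x_1 x_4, and x_2^2 or x_1 x_3 for x_0 x_4.\<close>
  define \<mu> :: "5 \<Rightarrow> nat" where "\<mu> i = (if i = 0 \<or> i = 4 then 0 else 1)" for i
  interpret module "(*) :: ('k, 5) mpoly \<Rightarrow> _" by (rule module_mult)
  show ?thesis
  proof (induction "weight \<mu> m" arbitrary: m rule: less_induct)
    case less
    show ?case
    proof (cases "reduced m")
      case True
      then show ?thesis using span_zero unfolding ideal_generated_def by (intro exI[of _ m]) auto
    next
      case False
      let ?l = "Poly_Mapping.lookup m"
      have split: "\<exists>r. m = r + (Poly_Mapping.single a 1 + Poly_Mapping.single b 1)"
        if "a = b \<and> ?l a \<ge> 2 \<or> a \<noteq> b \<and> ?l a \<ge> 1 \<and> ?l b \<ge> 1" for a b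
        using that
        by (intro exI[of _ "m - (Poly_Mapping.single a 1 + Poly_Mapping.single b 1)"] poly_mapping_eqI)
          (auto simp: lookup_add lookup_minus lookup_single when_def)
      have gens: "(mvar 3 * mvar 3 - mvar 1 * mvar 4 :: ('k, 5) mpoly) \<in> ideal_generated cusp_quadrics"
        "(mvar 1 * mvar 3 - mvar 0 * mvar 4 :: ('k, 5) mpoly) \<in> ideal_generated cusp_quadrics"
        "(mvar 2 * mvar 2 - mvar 0 * mvar 4 :: ('k, 5) mpoly) \<in> ideal_generated cusp_quadrics"
        "(mvar 1 * mvar 1 - mvar 0 * mvar 3 :: ('k, 5) mpoly) \<in> ideal_generated cusp_quadrics"
        unfolding ideal_generated_def
        by (rule span_base; simp add: cusp_quadrics_def power2_eq_square)+
      have "?l 1 \<ge> 2 \<or> ?l 2 \<ge> 2 \<or> ?l 3 \<ge> 2 \<or> ?l 1 \<ge> 1 \<and> ?l 3 \<ge> 1"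
        using False unfolding reduced_def by linarith
      then consider r where "m = r + (Poly_Mapping.single 1 1 + Poly_Mapping.single 1 1)"
        | r where "m = r + (Poly_Mapping.single 2 1 + Poly_Mapping.single 2 1)"
        | r where "m = r + (Poly_Mapping.single 3 1 + Poly_Mapping.single 3 1)"
        | r where "m = r + (Poly_Mapping.single 1 1 + Poly_Mapping.single 3 1)"
        using split[of 1 1] split[of 2 2] split[of 3 3] split[of 1 3] by auto
      then have "\<exists>m'. weight (\<lambda>_. 1) m' = weight (\<lambda>_. 1) m \<and> weight texp m' = weight texp m \<and>
          weight \<mu> m' < weight \<mu> m \<and>
          (Poly_Mapping.single m 1 - Poly_Mapping.single m' 1 :: ('k, 5) mpoly) \<in> ideal_generated cusp_quadrics"
      proof cases
        case 1 show ?thesis by (rule reduce_step[OF gens(4) 1]) (simp_all add: \<mu>_def)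
      next
        case 2 show ?thesis by (rule reduce_step[OF gens(3) 2]) (simp_all add: \<mu>_def)
      next
        case 3 show ?thesis by (rule reduce_step[OF gens(1) 3]) (simp_all add: \<mu>_def)
      next
        case 4 show ?thesis by (rule reduce_step[OF gens(2) 4]) (simp_all add: \<mu>_def)
      qed
      then obtain m' where m': "weight (\<lambda>_. 1) m' = weight (\<lambda>_. 1) m" "weight texp m' = weight texp m"
        "weight \<mu> m' < weight \<mu> m"
        "(Poly_Mapping.single m 1 - Poly_Mapping.single m' 1 :: ('k, 5) mpoly) \<in> ideal_generated cusp_quadrics" by blast
      obtain m'' where m'': "reduced m''" "weight (\<lambda>_. 1) m'' = weight (\<lambda>_. 1) m'" "weight texp m'' = weight texp m'"
        "(Poly_Mapping.single m' 1 - Poly_Mapping.single m'' 1 :: ('k, 5) mpoly) \<in> ideal_generated cusp_quadrics"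
        using less[OF m'(3)] by blast
      have "(Poly_Mapping.single m 1 - Poly_Mapping.single m'' 1 :: ('k, 5) mpoly) \<in> ideal_generated cusp_quadrics"
        using span_add[OF m'(4)[unfolded ideal_generated_def] m''(4)[unfolded ideal_generated_def]]
        unfolding ideal_generated_def by simp
      then show ?thesis using m' m'' by (intro exI[of _ m'']) auto
    qed
  qed
qed

text \<open>Modulo the quadrics p is congruent to q, where each monomial is replaced by its normal
  form. Within one degree the normal forms are told apart by their weight, so each nonempty sum
  giving a coefficient of q is a coefficient of p along the curve, and these vanish.\<close>

lemma vanishing_form_in_ideal:
  fixes p :: "('k::{alg_closed_field, field_char_0}, 5) mpoly"
  assumes p: "p \<in> forms d" and van: "\<And>v. v \<in> C0 \<Longrightarrow> meval p v = 0"
  shows "p \<in> ideal_generated cusp_quadrics"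
proof -
  interpret module "(*) :: ('k, 5) mpoly \<Rightarrow> _" by (rule module_mult)
  obtain nf where nf: "\<And>m. reduced (nf m)" "\<And>m. weight (\<lambda>_. 1) (nf m) = weight (\<lambda>_. 1) m"
      "\<And>m. weight texp (nf m) = weight texp m"
      "\<And>m. (Poly_Mapping.single m 1 - Poly_Mapping.single (nf m) 1 :: ('k, 5) mpoly) \<in> ideal_generated cusp_quadrics"
    using reduce_monomial by metis
  have "poly (along texp p) t = 0" for t
    unfolding poly_along nu_affine(1)[symmetric] by (intro van nu_in_C0) simp
  then have along_0: "along texp p = 0" using poly_all_0_iff_0 by blast
  define q where "q = (\<Sum>m\<in>Poly_Mapping.keys p. Poly_Mapping.single (nf m) (Poly_Mapping.lookup p m))"
  have "q = 0"
  proof (rule poly_mapping_eqI)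
    fix n
    have lookup_q: "Poly_Mapping.lookup q n = (\<Sum>m\<in>Poly_Mapping.keys p. if nf m = n then Poly_Mapping.lookup p m else 0)"
      unfolding q_def by (simp add: lookup_sum lookup_single when_def)
    show "Poly_Mapping.lookup q n = Poly_Mapping.lookup 0 n"
    proof (cases "\<exists>m\<^sub>0\<in>Poly_Mapping.keys p. nf m\<^sub>0 = n")
      case True
      then obtain m\<^sub>0 where m\<^sub>0: "m\<^sub>0 \<in> Poly_Mapping.keys p" "nf m\<^sub>0 = n" by blast
      have "nf m = n \<longleftrightarrow> weight texp m = weight texp m\<^sub>0" if "m \<in> Poly_Mapping.keys p" for m
      proof
        assume "weight texp m = weight texp m\<^sub>0"
        moreover have "weight (\<lambda>_. 1) m = weight (\<lambda>_. 1) m\<^sub>0"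
          using p that m\<^sub>0(1) unfolding forms_conv_weight by metis
        ultimately show "nf m = n" unfolding m\<^sub>0(2)[symmetric] by (intro reduced_unique) (simp_all only: nf)
      next
        assume "nf m = n"
        then show "weight texp m = weight texp m\<^sub>0" using nf(3) m\<^sub>0(2) by metis
      qed
      then have "Poly_Mapping.lookup q n = coeff (along texp p) (weight texp m\<^sub>0)"
        unfolding lookup_q coeff_along by (intro sum.cong) auto
      then show ?thesis by (simp add: along_0)
    next
      case False
      then show ?thesis unfolding lookup_q by (auto intro!: sum.neutral)
    qed
  qed
  have "p = (\<Sum>m\<in>Poly_Mapping.keys p. Poly_Mapping.single m (Poly_Mapping.lookup p m))"
    by (rule poly_mapping_eqI) (auto simp: lookup_sum lookup_single when_def in_keys_iff)
  then have "p = p - q" using \<open>q = 0\<close> by simp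
  also have "\<dots> = (\<Sum>m\<in>Poly_Mapping.keys p. mconst (Poly_Mapping.lookup p m) *
      (Poly_Mapping.single m 1 - Poly_Mapping.single (nf m) 1))"
    unfolding q_def
    by (subst (1) \<open>p = (\<Sum>m\<in>Poly_Mapping.keys p. Poly_Mapping.single m (Poly_Mapping.lookup p m))\<close>)
      (simp add: sum_subtractf right_diff_distrib mconst_def mult_single)
  finally have "p = (\<Sum>m\<in>Poly_Mapping.keys p. mconst (Poly_Mapping.lookup p m) *
      (Poly_Mapping.single m 1 - Poly_Mapping.single (nf m) 1))" .
  moreover have "\<dots> \<in> ideal_generated cusp_quadrics"
    using nf(4) unfolding ideal_generated_def by (intro span_sum span_scale)
  ultimately show ?thesis by simp
qed

lemma homogeneous_ideal_C0:
  "homogeneous_ideal (C0 :: ('k::{alg_closed_field, field_char_0} ^ 5) set) = ideal_generated cusp_quadrics"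
proof
  interpret module "(*) :: ('k, 5) mpoly \<Rightarrow> _" by (rule module_mult)
  interpret mscale: module "mscale :: 'k \<Rightarrow> ('k, 5) mpoly \<Rightarrow> _" by (rule module_mscale)
  show "homogeneous_ideal (C0 :: ('k ^ 5) set) \<subseteq> ideal_generated cusp_quadrics"
    unfolding homogeneous_ideal_def ideal_generated_def
    using vanishing_form_in_ideal[unfolded ideal_generated_def]
    by (intro span_minimal subspace_span) blast
  have diff: "(mvar a * mvar b - mvar c * mvar d :: ('k, 5) mpoly) \<in> forms 2" for a b c d :: 5
    using mscale.subspace_diff[OF subspace_forms qmon_in_forms[of "(a, b)"] qmon_in_forms[of "(c, d)"]]
    by (simp add: qmon_def)
  have "p \<in> forms 2 \<and> (\<forall>v\<in>C0. meval p v = 0)" if p: "p \<in> cusp_quadrics" for p :: "('k, 5) mpoly"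
  proof
    show "p \<in> forms 2" using p diff unfolding cusp_quadrics_def power2_eq_square by blast
    show "\<forall>v\<in>C0. meval p v = 0"
      using p unfolding cusp_quadrics_def C0_def
      by (auto simp: meval_diff meval_mult meval_mvar meval_power nu_def eval_nat_numeral)
  qed
  then show "ideal_generated cusp_quadrics \<subseteq> homogeneous_ideal (C0 :: ('k ^ 5) set)"
    unfolding homogeneous_ideal_def ideal_generated_def by (intro span_mono) blast
qed

theorem mainTheorem2:
  shows "homogeneous_ideal (C0 :: ('k::{alg_closed_field, field_char_0} ^ 5) set) =
      ideal_generated
        {mvar 3 ^ 2 - mvar 1 * mvar 4, mvar 1 * mvar 3 - mvar 0 * mvar 4,
         mvar 2 ^ 2 - mvar 0 * mvar 4, mvar 1 ^ 2 - mvar 0 * mvar 3} \<and>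
    two_Hilbert_semistable (C0 :: ('k ^ 5) set)"
  using homogeneous_ideal_C0 two_Hilbert_semistable_C0 unfolding cusp_quadrics_def by blast

end
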